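(* Let $1 \leq \delta \leq 2$. There are absolute constants $\alpha, C>0$ such that the following holds for every $n\in\mathbb{N}$: if $K\subset\mathbb{R}^n$ is a convex body whose minimal volume ellipsoid is the Euclidean unit ball $B_2^n$ (i.e., $K$ is in Löwner position), then there is a subset $X\subseteq K\cap S^{n-1}$ of cardinality $\operatorname{card}(X) \leq \alpha n^{\delta}$ such that $$K\subseteq B_{2}^{n} \subseteq C n^{2 - \frac{\delta}{2}} \operatorname{conv}(X).$$
   Context: A convex body in $\mathbb{R}^n$ is a compact convex subset of $\mathbb{R}^n$ with non-empty interior. $B_2^n$ and $S^{n-1}$ denote the Euclidean unit ball and unit sphere of $\mathbb{R}^n$, and $\operatorname{conv}(X)$ is the convex hull of $X$. The minimal volume ellipsoid of $K$ is the (unique) ellipsoid of minimal volume containing $K$; $K$ is in Löwner position if this ellipsoid is $B_2^n$. "Absolute constant" means that $\alpha$ and $C$ do not depend on $n$, $\delta$, or $K$. *)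

theory Defs
  imports "HOL-Analysis.Analysis" "HOL-Library.Function_Algebras"
begin

text \<open>
  The dimension \<open>n\<close> is quantified inside the theorem (the constants must not depend on it), so
  it cannot be a type. As in the library's \<^const>\<open>Euclidean_space\<close>, the space $R^n$ is the set of
  sequences vanishing from index \<open>n\<close> on. The pointwise vector space structure below makes
  \<^const>\<open>convex\<close>, \<open>convex hull\<close> and \<^const>\<open>linear\<close> available on sequences.
\<close>

instantiation "fun" :: (type, real_vector) real_vector
begin

definition scaleR_fun :: "real \<Rightarrow> ('a \<Rightarrow> 'b) \<Rightarrow> 'a \<Rightarrow> 'b"
  where "scaleR_fun r f = (\<lambda>i. r *\<^sub>R f i)"

instance
  by standard (simp_all add: scaleR_fun_def fun_eq_iff scaleR_add_right scaleR_add_left)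

end

lemma scaleR_fun_apply [simp]: "(r *\<^sub>R f) i = r *\<^sub>R f i"
  by (simp add: scaleR_fun_def)

definition euclidean_carrier :: "nat \<Rightarrow> (nat \<Rightarrow> real) set"
  where "euclidean_carrier n = topspace (Euclidean_space n)"

definition euclidean_unit_ball :: "nat \<Rightarrow> (nat \<Rightarrow> real) set"
  where "euclidean_unit_ball n = {x \<in> euclidean_carrier n. L2_set x {..<n} \<le> 1}"

definition euclidean_unit_sphere :: "nat \<Rightarrow> (nat \<Rightarrow> real) set"
  where "euclidean_unit_sphere n = {x \<in> euclidean_carrier n. L2_set x {..<n} = 1}"

definition convex_body :: "nat \<Rightarrow> (nat \<Rightarrow> real) set \<Rightarrow> bool"
  where "convex_body n K \<longleftrightarrow>
    compactin (Euclidean_space n) K \<and> convex K \<and> Euclidean_space n interior_of K \<noteq> {}"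

text \<open>
  Lebesgue measure on $R^n$: the product measure lives on functions that are \<^const>\<open>undefined\<close>
  outside \<open>{..<n}\<close>, hence the transport to sequences that are \<open>0\<close> there.
\<close>

definition euclidean_lborel :: "nat \<Rightarrow> (nat \<Rightarrow> real) measure"
  where "euclidean_lborel n =
    distr (\<Pi>\<^sub>M i\<in>{..<n}. lborel) borel (\<lambda>x i. if i < n then x i else 0)"

lemma measurable_euclidean_lborel:
  fixes n :: nat
  shows "(\<lambda>x i. if i < n then x i else 0)
    \<in> borel_measurable (\<Pi>\<^sub>M i\<in>{..<n}. (lborel :: real measure))"
proof (rule measurable_coordinatewise_then_product)
  fix i :: nat
  show "(\<lambda>x. if i < n then x i else 0) \<in> borel_measurable (\<Pi>\<^sub>M i\<in>{..<n}. (lborel :: real measure))"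
    by (cases "i < n") auto
qed

definition ellipsoid :: "nat \<Rightarrow> (nat \<Rightarrow> real) set \<Rightarrow> bool"
  where "ellipsoid n E \<longleftrightarrow>
    (\<exists>c T. c \<in> euclidean_carrier n \<and> linear T \<and>
           bij_betw T (euclidean_carrier n) (euclidean_carrier n) \<and>
           E = (\<lambda>x. c + T x) ` euclidean_unit_ball n)"

definition minimal_volume_ellipsoid :: "nat \<Rightarrow> (nat \<Rightarrow> real) set \<Rightarrow> (nat \<Rightarrow> real) set \<Rightarrow> bool"
  where "minimal_volume_ellipsoid n K E \<longleftrightarrow>
    ellipsoid n E \<and> K \<subseteq> E \<and>
    (\<forall>E'. ellipsoid n E' \<and> K \<subseteq> E' \<longrightarrow>
          emeasure (euclidean_lborel n) E \<le> emeasure (euclidean_lborel n) E')"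

definition loewner_position :: "nat \<Rightarrow> (nat \<Rightarrow> real) set \<Rightarrow> bool"
  where "loewner_position n K \<longleftrightarrow> minimal_volume_ellipsoid n K (euclidean_unit_ball n)"

end

theory Submission
  imports Defs
begin

text \<open>
  Minimality of the unit ball gives John's condition in dual form: every quadratic polynomial on the
  contact set whose average under the (isotropic, centred) contact measure is positive is
  nonnegative at some contact point. This is all that is needed to select unweighted contact points
  \<open>u\<^sub>1, \<dots>, u\<^sub>N\<close> one at a time. With \<open>A\<close> the running sum of the \<open>u u\<^sup>T\<close> and \<open>s\<close> the running sum of the
  \<open>u\<close>, the potential \<open>tr (A - l I)\<^bsup>-1\<^esup> + \<eta> |s|\<^sup>2\<close>, a one-sided version of the barrier of Batson,
  Spielman and Srivastava, grows by at most \<open>10 \<eta>\<close> per step while the barrier \<open>l\<close> moves from \<open>-K\<close>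
  in steps of \<open>1 / (20 n)\<close>. After \<open>N \<approx> 40 n K\<close> steps \<open>A \<ge> K I\<close> and \<open>|s|\<^sup>2 \<le> 20 N\<close>.

  For \<open>K\<close> of order \<open>n\<close> the sum \<open>s\<close> is negligible and the points span a ball of radius of order \<open>1 / n\<close>.
  For \<open>K = n powr (\<delta> - 1)\<close>, Caratheodory's theorem provides \<open>n + 1\<close> further contact points whose hull
  contains the vector of length \<open>1 / (81 n)\<close> opposite to \<open>s\<close>, which balances \<open>s\<close> at the cost of a
  total weight of order \<open>N + n |s|\<close>.
\<close>

section \<open>Self-adjoint operators on the first \<open>n\<close> coordinates\<close>

text \<open>Only the coordinates below \<open>n\<close> enter, so identities hold for arbitrary
  sequences; in return, vectors and operators are determined by it only below
  \<open>n\<close>.\<close>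

definition ip :: "nat \<Rightarrow> (nat \<Rightarrow> real) \<Rightarrow> (nat \<Rightarrow> real) \<Rightarrow> real"
  where "ip n x y = (\<Sum>i<n. x i * y i)"

definition unit_seq :: "nat \<Rightarrow> nat \<Rightarrow> real"
  where "unit_seq i = (\<lambda>j. if j = i then 1 else 0)"

lemma ip_commute: "ip n x y = ip n y x"
  by (simp add: ip_def mult.commute)

lemma ip_simps [simp]:
  "ip n (x + y) z = ip n x z + ip n y z" "ip n z (x + y) = ip n z x + ip n z y"
  "ip n (x - y) z = ip n x z - ip n y z" "ip n z (x - y) = ip n z x - ip n z y"
  "ip n (a *\<^sub>R x) z = a * ip n x z" "ip n z (a *\<^sub>R x) = a * ip n z x"
  "ip n (- x) z = - ip n x z" "ip n z (- x) = - ip n z x"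
  "ip n 0 z = 0" "ip n z 0 = 0"
  by (simp_all add: ip_def algebra_simps sum.distrib sum_subtractf sum_distrib_left sum_negf)

lemma sum_fun_apply: "(\<Sum>a\<in>A. f a) i = (\<Sum>a\<in>A. f a i)"
  by (induction A rule: infinite_finite_induct) simp_all

lemma ip_self_nonneg [simp]: "0 \<le> ip n x x"
  by (simp add: ip_def sum_nonneg)

lemma ip_unit_seq [simp]: "i < n \<Longrightarrow> ip n (unit_seq i) x = x i" "i < n \<Longrightarrow> ip n x (unit_seq i) = x i"
  by (simp_all add: ip_def unit_seq_def if_distrib[of "\<lambda>t. t * _"] if_distrib[of "\<lambda>t. _ * t"] cong: if_cong)

lemma ip_cong: "(\<And>i. i < n \<Longrightarrow> x i = x' i) \<Longrightarrow> (\<And>i. i < n \<Longrightarrow> y i = y' i) \<Longrightarrow> ip n x y = ip n x' y'"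
  by (simp add: ip_def)

lemma discriminant_bound:
  fixes a b c :: real
  assumes "\<And>t. 0 \<le> a + 2 * t * b + t\<^sup>2 * c" "0 \<le> c"
  shows "b\<^sup>2 \<le> a * c"
proof (cases "c = 0")
  case True
  have "b = 0"
  proof (rule ccontr)
    assume "b \<noteq> 0"
    then show False
      using assms(1)[of "- (a + 1) / (2 * b)"] True by (simp add: field_simps)
  qed
  then show ?thesis using True by simp
next
  case False
  then have "c > 0" using assms(2) by simp
  then show ?thesis
    using assms(1)[of "- b / c"] by (simp add: field_simps power2_eq_square)
qed

section \<open>Positive self-adjoint operators, traces and inverses\<close>

definition self_adjoint :: "nat \<Rightarrow> ((nat \<Rightarrow> real) \<Rightarrow> nat \<Rightarrow> real) \<Rightarrow> bool"
  where "self_adjoint n P \<longleftrightarrow> (\<forall>x y. ip n (P x) y = ip n x (P y))"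

definition op_trace :: "nat \<Rightarrow> ((nat \<Rightarrow> real) \<Rightarrow> nat \<Rightarrow> real) \<Rightarrow> real"
  where "op_trace n P = (\<Sum>i<n. ip n (unit_seq i) (P (unit_seq i)))"

lemma self_adjointD: "self_adjoint n P \<Longrightarrow> ip n (P x) y = ip n x (P y)"
  by (simp add: self_adjoint_def)

text \<open>Self-adjointness already forces additivity and homogeneity, up to coordinates from \<open>n\<close> on.\<close>

lemma self_adjoint_ip_simps:
  assumes "self_adjoint n P"
  shows "ip n z (P (x + y)) = ip n z (P x) + ip n z (P y)"
    and "ip n z (P (x - y)) = ip n z (P x) - ip n z (P y)"
    and "ip n z (P (a *\<^sub>R x)) = a * ip n z (P x)"
  by (simp_all flip: self_adjointD[OF assms])

lemma self_adjoint_intros: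
  fixes P Q :: "(nat \<Rightarrow> real) \<Rightarrow> nat \<Rightarrow> real" and s :: "nat \<Rightarrow> real"
  shows
  "self_adjoint n (\<lambda>x. x)"
  "self_adjoint n (\<lambda>x. ip n s x *\<^sub>R s)"
  "self_adjoint n P \<Longrightarrow> self_adjoint n (\<lambda>x. a *\<^sub>R P x)"
  "self_adjoint n P \<Longrightarrow> self_adjoint n Q \<Longrightarrow> self_adjoint n (\<lambda>x. P x + Q x)"
  "self_adjoint n P \<Longrightarrow> self_adjoint n Q \<Longrightarrow> self_adjoint n (\<lambda>x. P x - Q x)"
  "self_adjoint n P \<Longrightarrow> self_adjoint n (\<lambda>x. P (P x))"
proof -
  assume "self_adjoint n P"
  then show "self_adjoint n (\<lambda>x. P (P x))" unfolding self_adjoint_def by metis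
qed (simp_all add: self_adjoint_def ip_commute)

text \<open>The quadratic form of \<open>P\<close> is nonnegative on the line through
  \<open>x\<close> in direction \<open>y\<close>, so its discriminant is nonpositive.\<close>

lemma self_adjoint_Cauchy_Schwarz:
  assumes "self_adjoint n P" "\<And>x. 0 \<le> ip n x (P x)"
  shows "(ip n x (P y))\<^sup>2 \<le> ip n x (P x) * ip n y (P y)"
proof (rule discriminant_bound)
  fix t
  have "0 \<le> ip n (x + t *\<^sub>R y) (P (x + t *\<^sub>R y))" by (rule assms(2))
  also have "\<dots> = ip n x (P x) + t * (ip n x (P y) + ip n y (P x)) + t\<^sup>2 * ip n y (P y)"
    by (simp add: self_adjoint_ip_simps[OF assms(1)] algebra_simps power2_eq_square)
  also have "ip n y (P x) = ip n x (P y)"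
    by (metis assms(1) ip_commute self_adjointD)
  finally show "0 \<le> ip n x (P x) + 2 * t * ip n x (P y) + t\<^sup>2 * ip n y (P y)" by (simp add: algebra_simps)
qed (rule assms(2))

lemma ip_Cauchy_Schwarz: "(ip n x y)\<^sup>2 \<le> ip n x x * ip n y y"
  using self_adjoint_Cauchy_Schwarz[of n "\<lambda>x. x"] by (simp add: self_adjoint_intros)

lemma ip_le_of_sq: "ip n x x \<le> a\<^sup>2 \<Longrightarrow> ip n y y \<le> b\<^sup>2 \<Longrightarrow> 0 \<le> a \<Longrightarrow> 0 \<le> b \<Longrightarrow> \<bar>ip n x y\<bar> \<le> a * b"
proof (rule abs_le_square_iff[THEN iffD2, THEN order_trans])
  assume a: "ip n x x \<le> a\<^sup>2" "ip n y y \<le> b\<^sup>2" "0 \<le> a" "0 \<le> b"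
  have "ip n x x * ip n y y \<le> a\<^sup>2 * b\<^sup>2" by (intro mult_mono a) simp_all
  then show "(ip n x y)\<^sup>2 \<le> (a * b)\<^sup>2"
    using ip_Cauchy_Schwarz[of n x y] by (simp add: power_mult_distrib)
qed simp

text \<open>A positive operator is bounded by its trace, shown without eigenvalues: Cauchy-Schwarz
  for \<open>P\<close> against each \<open>unit_seq i\<close> gives |P x|^2 <= tr P <x, P x>, the
  ordinary one gives <x, P x>^2 <= |x|^2 |P x|^2, and a factor <x, P x> cancels.\<close>

lemma ip_le_op_trace:
  assumes "self_adjoint n P" "\<And>x. 0 \<le> ip n x (P x)"
  shows "ip n x (P x) \<le> op_trace n P * ip n x x"
proof -
  let ?q = "ip n x (P x)"
  have "ip n (P x) (P x) = (\<Sum>i<n. (ip n (unit_seq i) (P x))\<^sup>2)"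
    unfolding ip_def[of n "P x"] by (intro sum.cong) (simp_all add: power2_eq_square)
  also have "\<dots> \<le> (\<Sum>i<n. ip n (unit_seq i) (P (unit_seq i)) * ?q)"
    by (intro sum_mono self_adjoint_Cauchy_Schwarz assms)
  also have "\<dots> = op_trace n P * ?q"
    by (simp only: op_trace_def sum_distrib_right)
  finally have "ip n x x * ip n (P x) (P x) \<le> ip n x x * (op_trace n P * ?q)"
    by (simp add: mult_left_mono)
  then have "?q\<^sup>2 \<le> ip n x x * (op_trace n P * ?q)"
    using ip_Cauchy_Schwarz[of n x "P x"] by linarith
  then have "?q * ?q \<le> (op_trace n P * ip n x x) * ?q"
    by (simp add: power2_eq_square algebra_simps)
  moreover have "0 \<le> op_trace n P" unfolding op_trace_def by (intro sum_nonneg assms)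
  ultimately show ?thesis
    using assms(2)[of x] by (cases "?q = 0") (simp_all add: mult_le_cancel_right)
qed

text \<open>By self-adjointness the last condition says that \<open>B (P y)\<close> and \<open>y\<close> agree below \<open>n\<close>.\<close>

definition inverse_op :: "nat \<Rightarrow> ((nat \<Rightarrow> real) \<Rightarrow> nat \<Rightarrow> real) \<Rightarrow> ((nat \<Rightarrow> real) \<Rightarrow> nat \<Rightarrow> real) \<Rightarrow> bool"
  where "inverse_op n B P \<longleftrightarrow> self_adjoint n B \<and> self_adjoint n P \<and> (\<forall>x y. ip n (B x) (P y) = ip n x y)"

lemma inverse_opD:
  assumes "inverse_op n B P"
  shows "self_adjoint n B" "self_adjoint n P" "ip n (B x) (P y) = ip n x y" "ip n (P x) (B y) = ip n x y"
  using assms by (auto simp: inverse_op_def ip_commute)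

text \<open>A trace bound on the inverse keeps the spectrum of \<open>B\<close> away from 0.
  Cauchy-Schwarz for the form of \<open>P\<close> is applied at \<open>B x\<close> and
  \<open>x\<close>, where \<open>ip n (B x) (P x)\<close> is |x|^2.\<close>

lemma inverse_op_coercive:
  assumes "inverse_op n B P" "\<And>x. 0 \<le> ip n x (P x)" "op_trace n P \<le> \<tau>"
  shows "ip n x x \<le> \<tau> * ip n x (B x)"
proof -
  note inv = inverse_opD[OF assms(1)]
  have BPB: "ip n (B x) (P (B x)) = ip n x (B x)" by (rule inv(3))
  have nn: "0 \<le> ip n x (B x)" using assms(2)[of "B x"] by (simp only: BPB)
  have "(ip n x x)\<^sup>2 = (ip n (B x) (P x))\<^sup>2" by (simp add: inv)
  also have "\<dots> \<le> ip n x (B x) * ip n x (P x)"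
    using self_adjoint_Cauchy_Schwarz[OF inv(2) assms(2), of "B x" x] by (simp only: BPB)
  also have "\<dots> \<le> ip n x (B x) * (\<tau> * ip n x x)"
  proof (intro mult_left_mono nn)
    have "ip n x (P x) \<le> op_trace n P * ip n x x" by (intro ip_le_op_trace inv assms)
    also have "\<dots> \<le> \<tau> * ip n x x" by (intro mult_right_mono assms) simp
    finally show "ip n x (P x) \<le> \<tau> * ip n x x" .
  qed
  finally have "ip n x x * ip n x x \<le> (\<tau> * ip n x (B x)) * ip n x x"
    by (simp add: power2_eq_square algebra_simps)
  moreover have "0 \<le> op_trace n P" unfolding op_trace_def by (intro sum_nonneg assms)
  ultimately show ?thesis
    using nn assms(3) by (cases "ip n x x = 0") (simp_all add: mult_le_cancel_right less_le)
qed

text \<open>This is R - P = d P R tested against \<open>z\<close>; write \<open>z\<close> as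
  \<open>B (P z)\<close> and split off the multiple of the identity.\<close>

lemma resolvent_identity:
  fixes B R P :: "(nat \<Rightarrow> real) \<Rightarrow> nat \<Rightarrow> real"
  assumes "inverse_op n B P" "inverse_op n (\<lambda>x. B x - d *\<^sub>R x) R"
  shows "ip n z (R x) - ip n z (P x) = d * ip n (P z) (R x)"
proof -
  note P = inverse_opD[OF assms(1)] and R = inverse_opD[OF assms(2)]
  have "ip n z (R x) = ip n (B (P z)) (R x)" using P(4)[of z "R x"] self_adjointD[OF P(1)] by simp
  also have "\<dots> = ip n (B (P z) - d *\<^sub>R P z) (R x) + d * ip n (P z) (R x)" by simp
  also have "ip n (B (P z) - d *\<^sub>R P z) (R x) = ip n (P z) x" by (rule R(3))
  finally show ?thesis using self_adjointD[OF P(2)] by simp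
qed

text \<open>The cost of moving the barrier by \<open>d\<close>. By the resolvent identity it is d tr
  (P R), and a second use of the identity gives R^2 - P R = d R P R >= 0 as quadratic forms.\<close>

lemma op_trace_shift:
  fixes B R P :: "(nat \<Rightarrow> real) \<Rightarrow> nat \<Rightarrow> real"
  assumes inv: "inverse_op n B P" "inverse_op n (\<lambda>x. B x - d *\<^sub>R x) R"
    and nn: "\<And>x. 0 \<le> ip n x (P x)" and "0 \<le> d"
  shows "op_trace n R - op_trace n P \<le> d * op_trace n (\<lambda>x. R (R x))"
proof -
  note P = inverse_opD[OF inv(1)] and R = inverse_opD[OF inv(2)]
  have *: "ip n x (R x) - ip n x (P x) \<le> d * ip n x (R (R x))" for x
  proof -
    have "ip n (P x) (R x) \<le> ip n (R x) (R x)"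
      using resolvent_identity[OF inv, of "R x" x] nn[of "R x"] \<open>0 \<le> d\<close>
      by (simp add: ip_commute[of n "P x"] ip_commute[of n "P (R x)"])
        (metis diff_ge_0_iff_ge mult_nonneg_nonneg)
    then have "d * ip n (P x) (R x) \<le> d * ip n (R x) (R x)" using \<open>0 \<le> d\<close> by (rule mult_left_mono)
    then show ?thesis using resolvent_identity[OF inv, of x x] self_adjointD[OF R(2)] by simp
  qed
  show ?thesis
    unfolding op_trace_def sum_subtractf[symmetric] sum_distrib_left by (intro sum_mono *)
qed

text \<open>The rank-one update formula for inverses; nonnegativity of \<open>ip n u (R u)\<close>
  makes the denominator \<open>q\<close> at least 1.\<close>

lemma Sherman_Morrison:
  fixes B R :: "(nat \<Rightarrow> real) \<Rightarrow> nat \<Rightarrow> real" and u :: "nat \<Rightarrow> real"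
  assumes "inverse_op n B R" "0 \<le> ip n u (R u)"
  defines "q \<equiv> 1 + ip n u (R u)"
  shows "inverse_op n (\<lambda>x. B x + ip n u x *\<^sub>R u) (\<lambda>x. R x - (ip n (R u) x / q) *\<^sub>R R u)"
proof -
  note R = inverse_opD[OF assms(1)]
  have q: "q \<noteq> 0" using assms(2) by (simp add: q_def)
  have sa: "self_adjoint n (\<lambda>x. R x - (1 / q) *\<^sub>R (ip n (R u) x *\<^sub>R R u))"
    by (intro self_adjoint_intros R)
  have "ip n (B x + ip n u x *\<^sub>R u) (R y - (ip n (R u) y / q) *\<^sub>R R u) = ip n x y" for x y
  proof -
    have "ip n (B x + ip n u x *\<^sub>R u) (R y - (ip n (R u) y / q) *\<^sub>R R u)
      = ip n x y - ip n (R u) y / q * ip n x u + ip n u x * (ip n u (R y) - ip n (R u) y / q * ip n u (R u))"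
      by (simp add: R algebra_simps)
    moreover have "ip n u (R y) - ip n (R u) y / q * ip n u (R u) = ip n (R u) y / q"
      using q self_adjointD[OF R(2), of u y] by (simp add: q_def field_simps)
    ultimately show ?thesis by (simp add: ip_commute[of n x u])
  qed
  then show ?thesis using sa R(1) by (auto simp: inverse_op_def intro!: self_adjoint_intros)
qed

lemma op_trace_Sherman_Morrison:
  fixes R :: "(nat \<Rightarrow> real) \<Rightarrow> nat \<Rightarrow> real" and u :: "nat \<Rightarrow> real"
  shows "op_trace n (\<lambda>x. R x - (ip n (R u) x / q) *\<^sub>R R u) = op_trace n R - ip n (R u) (R u) / q"
proof -
  have "op_trace n (\<lambda>x. R x - (ip n (R u) x / q) *\<^sub>R R u)
    = op_trace n R - (\<Sum>i<n. ip n (R u) (unit_seq i) / q * ip n (unit_seq i) (R u))"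
    by (simp add: op_trace_def sum_subtractf)
  also have "(\<Sum>i<n. ip n (R u) (unit_seq i) / q * ip n (unit_seq i) (R u)) = (\<Sum>i<n. R u i / q * R u i)"
    by (intro sum.cong) simp_all
  also have "\<dots> = ip n (R u) (R u) / q" by (simp add: ip_def sum_divide_distrib)
  finally show ?thesis .
qed

section \<open>Linear algebra of the coordinate space\<close>

lemma euclidean_carrier_iff: "x \<in> euclidean_carrier n \<longleftrightarrow> (\<forall>i\<ge>n. x i = 0)"
  by (auto simp: euclidean_carrier_def topspace_Euclidean_space)

lemma subspace_euclidean_carrier: "subspace (euclidean_carrier n)"
  by (rule subspaceI) (auto simp: euclidean_carrier_iff)

lemma unit_seq_in_carrier: "i < n \<Longrightarrow> unit_seq i \<in> euclidean_carrier n"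
  by (auto simp: euclidean_carrier_iff unit_seq_def)

lemma inj_unit_seq: "inj_on unit_seq A"
  by (rule inj_onI) (metis unit_seq_def zero_neq_one)

lemma euclidean_carrier_eq_span: "euclidean_carrier n = span (unit_seq ` {..<n})"
proof
  show "euclidean_carrier n \<subseteq> span (unit_seq ` {..<n})"
  proof
    fix x assume x: "x \<in> euclidean_carrier n"
    have "x = (\<Sum>i<n. x i *\<^sub>R unit_seq i)"
    proof
      fix j
      show "x j = (\<Sum>i<n. x i *\<^sub>R unit_seq i) j"
        using x by (cases "j < n")
          (simp_all add: sum_fun_apply unit_seq_def euclidean_carrier_iff if_distrib[of "\<lambda>t. _ * t"] cong: if_cong)
    qed
    also have "\<dots> \<in> span (unit_seq ` {..<n})"
      by (intro span_sum span_scale span_base) auto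
    finally show "x \<in> span (unit_seq ` {..<n})" .
  qed
  show "span (unit_seq ` {..<n}) \<subseteq> euclidean_carrier n"
    by (rule span_minimal[OF _ subspace_euclidean_carrier]) (auto intro: unit_seq_in_carrier)
qed

lemma independent_unit_seq: "independent (unit_seq ` {..<n})"
proof (rule independent_if_scalars_zero)
  fix f x assume f: "(\<Sum>x\<in>unit_seq ` {..<n}. f x *\<^sub>R x) = 0" and "x \<in> unit_seq ` {..<n}"
  then obtain i where i: "i < n" "x = unit_seq i" by auto
  have "(\<Sum>j<n. f (unit_seq j) *\<^sub>R unit_seq j) = 0"
    using f by (simp add: sum.reindex inj_unit_seq)
  then have "(\<Sum>j<n. f (unit_seq j) *\<^sub>R unit_seq j) i = 0" by (metis zero_fun_apply)
  then show "f x = 0"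
    using i by (simp add: sum_fun_apply unit_seq_def if_distrib[of "\<lambda>t. _ * t"] cong: if_cong)
qed simp

text \<open>Dimension count: the images of the \<open>n\<close> unit vectors stay independent, and a
  vector of the carrier outside their span would give \<open>n + 1\<close> independent vectors in
  the span of \<open>n\<close>.\<close>

lemma linear_inj_on_carrier_surj:
  fixes f :: "(nat \<Rightarrow> real) \<Rightarrow> nat \<Rightarrow> real"
  assumes lin: "linear f" and maps: "f ` euclidean_carrier n \<subseteq> euclidean_carrier n"
    and inj: "inj_on f (euclidean_carrier n)"
  shows "f ` euclidean_carrier n = euclidean_carrier n"
proof
  let ?E = "unit_seq ` {..<n}"
  have ind: "independent (f ` ?E)"
    using linear_independent_injective_image[OF lin independent_unit_seq] inj
    by (simp add: euclidean_carrier_eq_span)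
  have "card (f ` ?E) = card ?E"
    by (rule card_image) (rule inj_on_subset[OF inj], auto simp: unit_seq_in_carrier)
  moreover have "f ` ?E \<subseteq> span ?E"
    using maps by (auto simp: euclidean_carrier_eq_span span_base)
  moreover have "y \<in> span (f ` ?E)" if y: "y \<in> span ?E" for y
  proof (rule ccontr)
    assume "y \<notin> span (f ` ?E)"
    then have "independent (insert y (f ` ?E))" and "y \<notin> f ` ?E"
      using ind by (auto simp: independent_insert intro: span_base)
    then have "card (insert y (f ` ?E)) \<le> card ?E"
      using independent_span_bound[of ?E "insert y (f ` ?E)"] calculation(2) y by simp
    then show False using \<open>y \<notin> f ` ?E\<close> calculation(1) by simp
  qed
  ultimately show "euclidean_carrier n \<subseteq> f ` euclidean_carrier n"
    by (auto simp: euclidean_carrier_eq_span simp flip: linear_span_image[OF lin])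
qed (rule maps)

lemma linear_bij_betw_carrier_inverse:
  fixes f :: "(nat \<Rightarrow> real) \<Rightarrow> nat \<Rightarrow> real"
  assumes "linear f" "f ` euclidean_carrier n \<subseteq> euclidean_carrier n" "inj_on f (euclidean_carrier n)"
  obtains g where "linear g" "bij_betw g (euclidean_carrier n) (euclidean_carrier n)"
    "\<And>x. x \<in> euclidean_carrier n \<Longrightarrow> g (f x) = x" "\<And>x. x \<in> euclidean_carrier n \<Longrightarrow> f (g x) = x"
proof -
  have "\<exists>g. linear g \<and> (\<forall>x\<in>euclidean_carrier n. g (f x) = x)"
    using linear_exists_left_inverse_on[OF assms(1) subspace_euclidean_carrier assms(3)] by auto
  then obtain g where g: "linear g" "\<forall>x\<in>euclidean_carrier n. g (f x) = x"
    by (elim exE conjE)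
  note surj = linear_inj_on_carrier_surj[OF assms]
  have fg: "f (g x) = x \<and> g x \<in> euclidean_carrier n" if x: "x \<in> euclidean_carrier n" for x
  proof -
    obtain y where y: "y \<in> euclidean_carrier n" "x = f y" using equalityD2[OF surj] x by auto
    then show ?thesis using bspec[OF g(2) y(1)] by simp
  qed
  have "bij_betw g (euclidean_carrier n) (euclidean_carrier n)"
  proof (rule bij_betw_byWitness[where f' = f])
    show "f ` euclidean_carrier n \<subseteq> euclidean_carrier n" by (rule assms(2))
    show "g ` euclidean_carrier n \<subseteq> euclidean_carrier n" using fg by blast
    show "\<forall>x\<in>euclidean_carrier n. f (g x) = x" using fg by blast
  qed (rule g(2))
  then show ?thesis using that[OF g(1)] g(2) fg by blast
qed

lemma ip_self_eq_0_iff: "ip n x x = 0 \<longleftrightarrow> (\<forall>i<n. x i = 0)"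
  by (auto simp: ip_def sum_nonneg_eq_0_iff)

text \<open>Coercivity makes \<open>B\<close> injective on the carrier, hence surjective there by
  the dimension count.\<close>

lemma coercive_imp_inverse_op:
  fixes B :: "(nat \<Rightarrow> real) \<Rightarrow> nat \<Rightarrow> real"
  assumes B: "self_adjoint n B" and c: "0 < c" "\<And>x. c * ip n x x \<le> ip n x (B x)"
  obtains R where "inverse_op n B R"
proof -
  \<comment> \<open>\<open>B\<close> is additive and homogeneous only in the coordinates below
    \<open>n\<close>; cutting off the others gives a genuinely linear map into the carrier.\<close>
  define f where "f = (\<lambda>x i. if i < n then B x i else 0)"
  have B_apply: "B x i = ip n (unit_seq i) (B x)" if "i < n" for x i
    using that by simp
  have "linear f"
    by (rule linearI) (auto simp: f_def fun_eq_iff B_apply self_adjoint_ip_simps[OF B] simp del: ip_unit_seq)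
  moreover have "f ` euclidean_carrier n \<subseteq> euclidean_carrier n"
    by (auto simp: f_def euclidean_carrier_iff)
  moreover have "inj_on f (euclidean_carrier n)"
  proof (rule inj_onI)
    fix x y assume xy: "x \<in> euclidean_carrier n" "y \<in> euclidean_carrier n" "f x = f y"
    have "ip n (x - y) (B x) = ip n (x - y) (B y)"
      by (rule ip_cong) (use xy(3) in \<open>auto simp: f_def fun_eq_iff split: if_splits\<close>)
    then have "ip n (x - y) (B (x - y)) = 0" by (simp only: self_adjoint_ip_simps[OF B])
    then have "ip n (x - y) (x - y) = 0"
      using c(2)[of "x - y"] c(1) ip_self_nonneg[of n "x - y"]
      by (simp del: ip_simps add: mult_le_0_iff)
    then have "\<forall>i<n. x i = y i" by (simp add: ip_self_eq_0_iff del: ip_simps)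
    then have "x i = y i" for i
      using xy(1,2) by (cases "i < n") (simp_all add: euclidean_carrier_iff)
    then show "x = y" by (rule ext)
  qed
  ultimately obtain g where g: "\<And>x. x \<in> euclidean_carrier n \<Longrightarrow> f (g x) = x"
    by (rule linear_bij_betw_carrier_inverse) blast
  define R where "R = (\<lambda>x. g (\<lambda>i. if i < n then x i else 0))"
  have BR: "ip n z (B (R y)) = ip n z y" for z y
  proof -
    have "f (R y) = (\<lambda>i. if i < n then y i else 0)"
      unfolding R_def by (rule g) (simp add: euclidean_carrier_iff)
    then have "B (R y) i = y i" if "i < n" for i
      using that by (auto simp: f_def fun_eq_iff split: if_splits)
    then show ?thesis by (intro ip_cong) auto
  qed
  have "ip n (B x) (R y) = ip n x y" for x y
    using BR self_adjointD[OF B] by simp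
  moreover have "self_adjoint n R"
    unfolding self_adjoint_def
    by (metis BR B ip_commute self_adjointD)
  ultimately show ?thesis using that B by (auto simp: inverse_op_def)
qed

text \<open>The trace bound gives B >= I / \<tau>, and d <= 1 / (4 \<tau>) preserves at least half
  of it, so \<open>R\<close> exists and R^2 <= 2 \<tau> R. Then tr R <= \<tau> + 2 d \<tau> tr R <=
  \<tau> + tr R / 2, and the last term is absorbed.\<close>

lemma shifted_inverse:
  fixes B P :: "(nat \<Rightarrow> real) \<Rightarrow> nat \<Rightarrow> real"
  assumes inv: "inverse_op n B P" and nn: "\<And>x. 0 \<le> ip n x (P x)"
    and \<tau>: "op_trace n P \<le> \<tau>" "0 < \<tau>" and d: "0 \<le> d" "4 * d * \<tau> \<le> 1"
  obtains R where "inverse_op n (\<lambda>x. B x - d *\<^sub>R x) R" "\<And>x. 0 \<le> ip n x (R x)"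
    "op_trace n R \<le> 2 * \<tau>"
proof -
  note P = inverse_opD[OF inv]
  let ?B = "\<lambda>x. B x - d *\<^sub>R x"
  have coercive: "1 / (2 * \<tau>) * ip n x x \<le> ip n x (?B x)" for x
  proof -
    have "ip n x x \<le> \<tau> * ip n x (B x)" by (rule inverse_op_coercive[OF inv nn \<tau>(1)])
    moreover have "4 * d * \<tau> * ip n x x \<le> 1 * ip n x x" by (intro mult_right_mono d) simp
    moreover have "d * \<tau> * ip n x x \<ge> 0" using d \<tau>(2) by simp
    ultimately have "2 * d * \<tau> * ip n x x + ip n x x \<le> 2 * \<tau> * ip n x (B x)"
      using ip_self_nonneg[of n x] by linarith
    then show ?thesis using \<tau>(2) by (simp add: field_simps)
  qed
  have "self_adjoint n ?B" by (intro self_adjoint_intros P)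
  then obtain R where R: "inverse_op n ?B R"
    using coercive_imp_inverse_op[of n ?B "1 / (2 * \<tau>)"] coercive \<tau>(2) by auto
  note R' = inverse_opD[OF R]
  have sq: "ip n (R x) (R x) \<le> 2 * \<tau> * ip n x (R x)" for x
  proof -
    have "1 / (2 * \<tau>) * ip n (R x) (R x) \<le> ip n x (R x)"
      using coercive[of "R x"] by (simp only: R'(4))
    then show ?thesis using \<tau>(2) by (simp add: field_simps)
  qed
  have nnR: "0 \<le> ip n x (R x)" for x
    using order_trans[OF ip_self_nonneg sq[of x]] \<tau>(2) by (simp add: zero_le_mult_iff)
  have "op_trace n (\<lambda>x. R (R x)) \<le> 2 * \<tau> * op_trace n R"
    unfolding op_trace_def sum_distrib_left
    by (intro sum_mono) (use sq self_adjointD[OF R'(2)] in \<open>simp del: ip_unit_seq\<close>)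
  then have "d * op_trace n (\<lambda>x. R (R x)) \<le> d * (2 * \<tau> * op_trace n R)" by (intro mult_left_mono d)
  then have "op_trace n R \<le> \<tau> + d * (2 * \<tau> * op_trace n R)"
    using op_trace_shift[OF inv R nn d(1)] \<tau>(1) by linarith
  moreover have "2 * d * \<tau> * op_trace n R \<le> 1/2 * op_trace n R"
    by (rule mult_right_mono) (use d(2) nnR in \<open>auto simp: op_trace_def intro!: sum_nonneg simp del: ip_unit_seq\<close>)
  ultimately have "op_trace n R \<le> 2 * \<tau>" by (simp add: algebra_simps)
  then show ?thesis by (intro that[OF R nnR])
qed

text \<open>Dual form of John's decomposition of the identity: \<open>\<Sum>i<n. M i i\<close> is \<open>n\<close> times the average of
  the quadratic polynomial under the contact measure.\<close>

definition isotropic_dual :: "nat \<Rightarrow> (nat \<Rightarrow> real) set \<Rightarrow> bool"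
  where "isotropic_dual n S \<longleftrightarrow> (\<forall>u\<in>S. ip n u u = 1) \<and>
    (\<forall>M h. 0 < (\<Sum>i<n. M i i) \<longrightarrow> (\<exists>u\<in>S. 0 \<le> (\<Sum>i<n. \<Sum>j<n. M i j * u i * u j) + ip n h u))"

text \<open>Passes from matrices to operators: \<open>M\<close> is the matrix of \<open>Q\<close> in
  the unit vectors.\<close>

lemma isotropic_dual_test:
  fixes Q :: "(nat \<Rightarrow> real) \<Rightarrow> nat \<Rightarrow> real"
  assumes S: "isotropic_dual n S" and Q: "self_adjoint n Q" "0 < op_trace n Q"
  obtains u where "u \<in> S" "ip n u u = 1" "0 \<le> ip n u (Q u) + ip n h u"
proof -
  define M where "M = (\<lambda>i j. ip n (unit_seq i) (Q (unit_seq j)))"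
  have "ip n u (Q u) = (\<Sum>i<n. \<Sum>j<n. M i j * u i * u j)" for u
  proof -
    have "Q u i = (\<Sum>j<n. M i j * u j)" if "i < n" for i
    proof -
      have "Q u i = ip n (Q (unit_seq i)) u" using that self_adjointD[OF Q(1)] by simp
      also have "\<dots> = (\<Sum>j<n. M i j * u j)"
        unfolding ip_def[of n _ u]
      proof (intro sum.cong refl)
        fix j assume "j \<in> {..<n}"
        then have "Q (unit_seq i) j = ip n (unit_seq j) (Q (unit_seq i))" by simp
        also have "\<dots> = M i j" unfolding M_def by (metis Q(1) ip_commute self_adjointD)
        finally show "Q (unit_seq i) j * u j = M i j * u j" by simp
      qed
      finally show ?thesis .
    qed
    then show ?thesis unfolding ip_def[of n u] by (simp add: sum_distrib_left mult_ac)
  qed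
  moreover have "(\<Sum>i<n. M i i) = op_trace n Q" by (simp only: M_def op_trace_def)
  ultimately have "\<exists>u\<in>S. 0 \<le> ip n u (Q u) + ip n h u"
    using S Q(2) unfolding isotropic_dual_def by simp
  then show ?thesis using S that unfolding isotropic_dual_def by blast
qed

section \<open>The barrier argument\<close>

lemma unit_seq_apply_self [simp]: "unit_seq i i = 1"
  by (simp add: unit_seq_def)

lemma sum_list_fun_apply: "(\<Sum>a\<leftarrow>as. f a) i = (\<Sum>a\<leftarrow>as. f a i)"
  by (induction as) simp_all

lemma ip_sum_list: "ip n x (\<Sum>a\<leftarrow>as. f a) = (\<Sum>a\<leftarrow>as. ip n x (f a))"
proof (induction as)
  case (Cons a as)
  have "sum_list (map f (a # as)) = f a + sum_list (map f as)" by simp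
  then have "ip n x (sum_list (map f (a # as))) = ip n x (f a + sum_list (map f as))" by (rule arg_cong)
  then show ?case by (simp only: ip_simps Cons.IH list.map sum_list.Cons)
qed (simp add: ip_def)

lemma op_trace_simps:
  fixes s :: "nat \<Rightarrow> real"
  shows
  "op_trace n (\<lambda>x. P x + Q x) = op_trace n P + op_trace n Q"
  "op_trace n (\<lambda>x. P x - Q x) = op_trace n P - op_trace n Q"
  "op_trace n (\<lambda>x. a *\<^sub>R P x) = a * op_trace n P"
  "op_trace n (\<lambda>x. x) = real n"
  "op_trace n (\<lambda>x. ip n s x *\<^sub>R s) = ip n s s"
  by (simp_all only: op_trace_def ip_simps sum.distrib sum_subtractf sum_distrib_left)
    (simp_all add: ip_def[of n s s] unit_seq_apply_self)

text \<open>Shifting the barrier costs \<open>D\<close>; adding \<open>u\<close> regains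
  \<open>w / (1 + q)\<close> by the rank-one update and changes |s|^2 by
  \<open>2 * \<sigma> + 1\<close>. So
  \<open>(D + \<eta> * (2 * \<sigma> + 1 - c)) * (1 + q) \<le> w\<close> is wanted for some contact
  point \<open>u\<close>. Apart from the cubic term \<open>2 * \<eta> * \<sigma> * q\<close> this
  follows from a quadratic condition, to which \<open>isotropic_dual\<close> applies; the slack
  \<open>c - 1\<close> pays for the bias \<open>s\<close>.\<close>

lemma barrier_step:
  fixes B P :: "(nat \<Rightarrow> real) \<Rightarrow> nat \<Rightarrow> real" and s :: "nat \<Rightarrow> real"
  assumes S: "isotropic_dual n S"
    and inv: "inverse_op n B P" and nn: "\<And>x. 0 \<le> ip n x (P x)"
    and \<tau>: "op_trace n P \<le> \<tau>" "0 < \<tau>" and d: "0 \<le> d" "4 * d * (real n + 2 * \<tau>) \<le> 1"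
    and \<eta>: "0 < \<eta>" "4 * \<eta> * ip n s s < (c - 1) * real n" and c: "1 \<le> c"
  obtains u P' where "u \<in> S" "inverse_op n (\<lambda>x. B x - d *\<^sub>R x + ip n u x *\<^sub>R u) P'"
    "\<And>x. 0 \<le> ip n x (P' x)"
    "op_trace n P' + \<eta> * ip n (s + u) (s + u) \<le> op_trace n P + \<eta> * ip n s s + \<eta> * c"
proof -
  have "4 * d * \<tau> \<le> 1"
    using d(2) mult_nonneg_nonneg[OF d(1), of "real n"] mult_nonneg_nonneg[OF d(1), of \<tau>] \<tau>(2)
    by (simp add: ring_distribs mult.assoc)
  then obtain R where R: "inverse_op n (\<lambda>x. B x - d *\<^sub>R x) R" "\<And>x. 0 \<le> ip n x (R x)"
    "op_trace n R \<le> 2 * \<tau>"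
    using shifted_inverse[OF inv nn \<tau> d(1)] by blast
  note R' = inverse_opD[OF R(1)]
  define D where "D = op_trace n R - op_trace n P"
  define T where "T = op_trace n (\<lambda>x. R (R x))"
  have RR: "ip n x (R (R x)) = ip n (R x) (R x)" for x using self_adjointD[OF R'(2)] by simp
  have T0: "0 \<le> T" unfolding T_def op_trace_def by (intro sum_nonneg) (simp del: ip_unit_seq add: RR)
  have trR0: "0 \<le> op_trace n R" unfolding op_trace_def by (intro sum_nonneg R)
  \<comment> \<open>The purpose of the bound on \<open>d\<close>: the shift uses up only a quarter
    of \<open>T\<close>, the trace of R^2, which stands for the gain \<open>w\<close>.\<close>
  have D: "D * (real n + op_trace n R) \<le> T / 4"
  proof -
    have "D * (real n + op_trace n R) \<le> (d * T) * (real n + op_trace n R)"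
      using op_trace_shift[OF inv R(1) nn d(1)] trR0 by (intro mult_right_mono) (simp_all add: D_def T_def)
    also have "\<dots> \<le> (d * T) * (real n + 2 * \<tau>)"
      using R(3) T0 d(1) by (intro mult_left_mono) simp_all
    also have "\<dots> = (d * (real n + 2 * \<tau>)) * T" by simp
    also have "\<dots> \<le> (1 / 4) * T" using d(2) T0 by (intro mult_right_mono) simp_all
    finally show ?thesis by simp
  qed
  \<comment> \<open>The quadratic part of the condition on \<open>u\<close>. The withheld quarter of
    R^2 and the term with \<open>4 * \<eta>\<^sup>2\<close> dominate the cubic term; the linear part
    is supplied below by \<open>(- 2 * \<eta>) *\<^sub>R s\<close>.\<close>
  define Q where "Q = (\<lambda>x. (3/4) *\<^sub>R R (R x) - D *\<^sub>R x - D *\<^sub>R R x + (\<eta> * (c - 1)) *\<^sub>R x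
    - (4 * \<eta>\<^sup>2) *\<^sub>R (ip n s x *\<^sub>R s))"
  have Q: "self_adjoint n Q" unfolding Q_def by (intro self_adjoint_intros R')
  have "\<eta> * (4 * \<eta> * ip n s s) < \<eta> * ((c - 1) * real n)"
    using \<eta> by (intro mult_strict_left_mono)
  then have "0 < op_trace n Q"
    unfolding Q_def op_trace_simps T_def[symmetric] using D T0
    by (simp add: algebra_simps power2_eq_square)
  then obtain u where u: "u \<in> S" "ip n u u = 1" "0 \<le> ip n u (Q u) + ip n ((- 2 * \<eta>) *\<^sub>R s) u"
    using isotropic_dual_test[OF S Q] by blast
  define q w \<sigma> where "q = ip n u (R u)" and "w = ip n (R u) (R u)" and "\<sigma> = ip n s u"
  have q0: "0 \<le> q" unfolding q_def by (rule R)
  have "q\<^sup>2 \<le> w" using ip_Cauchy_Schwarz[of n u "R u"] u(2) by (simp add: q_def w_def)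
  \<comment> \<open>Splits the cubic term into \<open>4 * \<eta>\<^sup>2 * \<sigma>\<^sup>2\<close>
    and \<open>q\<^sup>2 / 4\<close>, the latter at most \<open>w / 4\<close> as \<open>u\<close> is
    a unit vector.\<close>
  moreover have "0 \<le> (2 * \<eta> * \<sigma> - q / 2)\<^sup>2" by simp
  ultimately have "2 * \<eta> * \<sigma> * q \<le> 4 * \<eta>\<^sup>2 * \<sigma>\<^sup>2 + w / 4" by (simp add: power2_eq_square field_simps)
  moreover have "D + D * q + 2 * \<eta> * \<sigma> - \<eta> * (c - 1) \<le> 3 / 4 * w - 4 * \<eta>\<^sup>2 * \<sigma>\<^sup>2"
    using u(2,3) by (simp add: Q_def RR q_def w_def \<sigma>_def ip_commute[of n u s] algebra_simps power2_eq_square)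
  moreover have "0 \<le> \<eta> * (c - 1) * q" using \<eta> c q0 by simp
  ultimately have "(D + \<eta> * (2 * \<sigma> + 1 - c)) * (1 + q) \<le> w" by (simp add: algebra_simps)
  then have step: "D + \<eta> * (2 * \<sigma> + 1 - c) \<le> w / (1 + q)" using q0 by (simp add: pos_le_divide_eq)
  define P' where "P' = (\<lambda>x. R x - (ip n (R u) x / (1 + q)) *\<^sub>R R u)"
  have inv': "inverse_op n (\<lambda>x. B x - d *\<^sub>R x + ip n u x *\<^sub>R u) P'"
    unfolding P'_def q_def using Sherman_Morrison[OF R(1), of u] R(2) by simp
  have nn': "0 \<le> ip n x (P' x)" for x
  proof -
    have "(ip n (R u) x)\<^sup>2 \<le> q * ip n x (R x)"
      using self_adjoint_Cauchy_Schwarz[OF R'(2) R(2), of u x] self_adjointD[OF R'(2), of u x] by (simp add: q_def)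
    also have "\<dots> \<le> (1 + q) * ip n x (R x)" using R(2) by (intro mult_right_mono) simp_all
    finally show ?thesis using q0
      by (simp add: P'_def ip_commute[of n x "R u"] power2_eq_square field_simps)
  qed
  have "op_trace n P' = op_trace n R - w / (1 + q)"
    unfolding P'_def w_def by (rule op_trace_Sherman_Morrison)
  moreover have "ip n (s + u) (s + u) = ip n s s + 2 * \<sigma> + 1"
    using u(2) by (simp add: \<sigma>_def ip_commute[of n u s])
  ultimately have "op_trace n P' + \<eta> * ip n (s + u) (s + u) \<le> op_trace n P + \<eta> * ip n s s + \<eta> * c"
    using step by (simp add: D_def algebra_simps)
  then show ?thesis using that[OF u(1) inv'] nn' by blast
qed

lemma greedy_contact_points:
  assumes S: "isotropic_dual n S" and n: "1 \<le> n" and K: "1 \<le> K" and N: "40 * real n * K \<le> real N"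
  obtains us where "length us = N" "set us \<subseteq> S"
    "\<And>x. K * ip n x x \<le> (\<Sum>u\<leftarrow>us. (ip n u x)\<^sup>2)"
    "ip n (sum_list us) (sum_list us) \<le> 20 * real N"
proof -
  \<comment> \<open>\<open>d * N \<ge> 2 * K\<close> lets the barrier travel from -K to at least K.
    The potential starts at n / K and \<open>\<eta>\<close> is tuned so that \<open>N\<close> steps
    add another n / K, whence the bound \<open>\<tau>\<close>. As \<open>K \<ge> 1\<close>, \<tau>
    <= 2 n, so each step is admissible with \<open>c = 10\<close>: 4 d (n + 2 \<tau>) <= 20 n d = 1,
    and 4 \<eta> |s|^2 <= 4 \<tau> <= 8 n < 9 n.\<close>
  define d \<tau> \<eta> where "d = 1 / (20 * real n)" and "\<tau> = 2 * real n / K"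
    and "\<eta> = real n / (10 * K * real N)"
  have nK: "0 < real n" "0 < K" using n K by auto
  have N0: "0 < real N" using N mult_pos_pos[OF nK] by linarith
  have \<eta>0: "0 < \<eta>" using nK N0 by (simp add: \<eta>_def)
  have \<eta>N: "\<eta> * 10 * real N = real n / K" using nK N0 by (simp add: \<eta>_def)
  have \<tau>0: "0 < \<tau>" and \<tau>n: "\<tau> \<le> 2 * real n" using nK K by (simp_all add: \<tau>_def field_simps)
  define B where "B = (\<lambda>us k x. (\<Sum>u\<leftarrow>us. ip n u x *\<^sub>R u) + (K - d * real k) *\<^sub>R x)"
  have "k \<le> N \<Longrightarrow> \<exists>us P. length us = k \<and> set us \<subseteq> S \<and> inverse_op n (B us k) P
      \<and> (\<forall>x. 0 \<le> ip n x (P x))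
      \<and> op_trace n P + \<eta> * ip n (sum_list us) (sum_list us) \<le> real n / K + \<eta> * 10 * real k" for k
  proof (induction k)
    case 0
    define P where "P = (\<lambda>x :: nat \<Rightarrow> real. (1 / K) *\<^sub>R x)"
    have "inverse_op n (B [] 0) P"
      using nK unfolding inverse_op_def B_def P_def
      by (auto intro!: self_adjoint_intros)
    moreover have "op_trace n P = real n / K" unfolding P_def op_trace_simps by simp
    moreover have "0 \<le> ip n x (P x)" for x using nK by (simp add: P_def)
    moreover have "ip n (sum_list []) (sum_list []) = 0" by (simp add: ip_def)
    ultimately show ?case by (intro exI[of _ "[]"] exI[of _ P]) (simp del: sum_list.Nil)
  next
    case (Suc k)
    then obtain us P where us: "length us = k" "set us \<subseteq> S" "inverse_op n (B us k) P"
      "\<And>x. 0 \<le> ip n x (P x)"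
      "op_trace n P + \<eta> * ip n (sum_list us) (sum_list us) \<le> real n / K + \<eta> * 10 * real k"
      by auto
    let ?s = "sum_list us"
    have "\<eta> * 10 * real k \<le> \<eta> * 10 * real N" using Suc.prems \<eta>0 by simp
    then have le: "op_trace n P + \<eta> * ip n ?s ?s \<le> \<tau>" using us(5) \<eta>N by (simp add: \<tau>_def)
    have "0 \<le> op_trace n P" unfolding op_trace_def by (intro sum_nonneg us)
    moreover have "0 \<le> \<eta> * ip n ?s ?s" using \<eta>0 by simp
    ultimately have P\<tau>: "op_trace n P \<le> \<tau>" and s\<tau>: "\<eta> * ip n ?s ?s \<le> \<tau>" using le by auto
    have d: "0 \<le> d" "4 * d * (real n + 2 * \<tau>) \<le> 1"
      using nK \<tau>n by (simp_all add: d_def divide_simps)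
    have s: "4 * \<eta> * ip n ?s ?s < (10 - 1) * real n" 
    proof -
      have "4 * (\<eta> * ip n ?s ?s) \<le> 4 * (2 * real n)"
        by (intro mult_left_mono order_trans[OF s\<tau> \<tau>n]) simp
      also have "\<dots> < (10 - 1) * real n" using nK by simp
      finally show ?thesis by (simp only: mult.assoc)
    qed
    obtain u P' where u: "u \<in> S" "inverse_op n (\<lambda>x. B us k x - d *\<^sub>R x + ip n u x *\<^sub>R u) P'"
      "\<And>x. 0 \<le> ip n x (P' x)"
      "op_trace n P' + \<eta> * ip n (?s + u) (?s + u) \<le> op_trace n P + \<eta> * ip n ?s ?s + \<eta> * 10"
      by (rule barrier_step[OF S us(3,4) P\<tau> \<tau>0 d \<eta>0 s]) auto
    have "(\<lambda>x. B us k x - d *\<^sub>R x + ip n u x *\<^sub>R u) = B (u # us) (Suc k)"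
      by (auto simp: B_def fun_eq_iff algebra_simps)
    moreover have "op_trace n P' + \<eta> * ip n (sum_list (u # us)) (sum_list (u # us))
        \<le> real n / K + \<eta> * 10 * real (Suc k)"
    proof -
      have "?s + u = sum_list (u # us)" by (simp add: add.commute)
      then have "op_trace n P' + \<eta> * ip n (sum_list (u # us)) (sum_list (u # us))
          \<le> op_trace n P + \<eta> * ip n ?s ?s + \<eta> * 10" using u(4) by (simp only:)
      also have "\<dots> \<le> real n / K + \<eta> * 10 * real k + \<eta> * 10" using us(5) by (rule add_right_mono)
      finally show ?thesis by (simp add: algebra_simps del: sum_list.Cons)
    qed
    ultimately show ?case
      using us(1,2) u(1-3) by (intro exI[of _ "u # us"] exI[of _ P']) (simp del: sum_list.Cons)
  qed
  then obtain us P where us: "length us = N" "set us \<subseteq> S" "inverse_op n (B us N) P"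
      "\<And>x. 0 \<le> ip n x (P x)"
      "op_trace n P + \<eta> * ip n (sum_list us) (sum_list us) \<le> real n / K + \<eta> * 10 * real N"
    by blast
  have "K * ip n x x \<le> (\<Sum>u\<leftarrow>us. (ip n u x)\<^sup>2)" for x
  proof -
    \<comment> \<open>Positivity passes from \<open>P\<close> to \<open>B\<close> on evaluating the
      form of \<open>P\<close> at \<open>B us N x\<close>; this says that A >= (d N - K) I.\<close>
    have "0 \<le> ip n (B us N x) (P (B us N x))" by (rule us)
    also have "\<dots> = ip n x (B us N x)" by (rule inverse_opD[OF us(3)])
    also have "\<dots> = (\<Sum>u\<leftarrow>us. (ip n u x)\<^sup>2) + (K - d * real N) * ip n x x"
      by (simp add: B_def ip_sum_list power2_eq_square ip_commute)
    finally have "(d * real N - K) * ip n x x \<le> (\<Sum>u\<leftarrow>us. (ip n u x)\<^sup>2)" by (simp add: algebra_simps)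
    moreover have "K * ip n x x \<le> (d * real N - K) * ip n x x"
      using N nK by (intro mult_right_mono) (simp_all add: d_def field_simps)
    ultimately show ?thesis by linarith
  qed
  moreover have "ip n (sum_list us) (sum_list us) \<le> 20 * real N"
  proof -
    have "0 \<le> op_trace n P" unfolding op_trace_def by (intro sum_nonneg us)
    \<comment> \<open>The final potential is at most 2 n / K, which is 20 \<eta> N by the choice of
      \<open>\<eta>\<close>.\<close>
    then have "\<eta> * ip n (sum_list us) (sum_list us) \<le> \<eta> * (20 * real N)" using us(5) \<eta>N by simp
    then show ?thesis using \<eta>0 by simp
  qed
  ultimately show ?thesis using that us by blast
qed

section \<open>Convex hulls of finite sets of sequences\<close>

text \<open>The hull of \<open>insert a X\<close> is the image of [0, 1] times the hull of
  \<open>X\<close> under a map continuous in each coordinate, hence in the product topology.\<close>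

lemma compact_convex_hull_finite:
  fixes X :: "(nat \<Rightarrow> real) set"
  assumes "finite X"
  shows "compact (convex hull X)"
  using assms
proof induction
  case (insert a X)
  show ?case
  proof (cases "X = {}")
    case False
    let ?f = "\<lambda>(u, b). \<lambda>i. u * a i + (1 - u) * b i :: real"
    have "convex hull (insert a X) = ?f ` ({0..1} \<times> (convex hull X))"
    proof (intro equalityI subsetI)
      fix x assume "x \<in> convex hull (insert a X)"
      then obtain u v b where *: "0 \<le> u" "0 \<le> v" "u + v = 1" "b \<in> convex hull X" "x = u *\<^sub>R a + v *\<^sub>R b"
        using convex_hull_insert[OF False, of a] by auto
      then show "x \<in> ?f ` ({0..1} \<times> (convex hull X))"
        by (intro image_eqI[of _ _ "(u, b)"]) (auto simp: fun_eq_iff)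
    next
      fix x assume "x \<in> ?f ` ({0..1} \<times> (convex hull X))"
      then obtain u b where *: "0 \<le> u" "u \<le> 1" "b \<in> convex hull X" "x = ?f (u, b)" by auto
      have "x = u *\<^sub>R a + (1 - u) *\<^sub>R b" using * by (auto simp: fun_eq_iff)
      moreover have "a \<in> convex hull (insert a X)" "b \<in> convex hull (insert a X)"
        using *(3) hull_mono[of X "insert a X" convex] by (auto intro: hull_inc)
      ultimately show "x \<in> convex hull (insert a X)"
        using * convexD[OF convex_convex_hull, of a "insert a X" b u "1 - u"] by simp
    qed
    moreover have "continuous_on ({0..1} \<times> (convex hull X)) ?f"
    proof (rule continuous_on_coordinatewise_then_product)
      fix i
      have "continuous_on UNIV (\<lambda>b :: nat \<Rightarrow> real. b i)"
        by (rule continuous_on_product_coordinates)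
      then have "continuous_on ({0..1} \<times> (convex hull X)) (\<lambda>x :: real \<times> (nat \<Rightarrow> real). snd x i)"
        by (rule continuous_on_compose2) (auto intro: continuous_intros)
      then have "continuous_on ({0..1} \<times> (convex hull X))
          (\<lambda>x :: real \<times> (nat \<Rightarrow> real). fst x * a i + (1 - fst x) * snd x i)"
        by (intro continuous_intros)
      then show "continuous_on ({0..1} \<times> (convex hull X)) (\<lambda>x. ?f x i)"
        by (simp add: case_prod_beta)
    qed
    ultimately show ?thesis
      by (simp only:) (intro compact_continuous_image compact_Times compact_Icc insert.IH)
  qed simp
qed simp

lemma continuous_on_ip:
  "continuous_on A f \<Longrightarrow> continuous_on A g \<Longrightarrow> continuous_on A (\<lambda>x. ip n (f x) (g x))"
  unfolding ip_def
  by (intro continuous_on_sum continuous_on_mult) (auto intro: continuous_on_product_then_coordinatewise)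

text \<open>The direction is \<open>p - z\<close> for a point \<open>z\<close> of the hull nearest
  to \<open>p\<close>, which exists by compactness; moving from \<open>z\<close> towards a point
  with larger inner product would come closer to \<open>p\<close>.\<close>

lemma convex_hull_separation:
  fixes X :: "(nat \<Rightarrow> real) set"
  assumes X: "finite X" "X \<noteq> {}" "X \<subseteq> euclidean_carrier n"
    and p: "p \<in> euclidean_carrier n" "p \<notin> convex hull X"
  obtains \<theta> where "\<And>x. x \<in> X \<Longrightarrow> ip n x \<theta> < ip n p \<theta>"
proof -
  have "continuous_on (convex hull X) (\<lambda>x i. p i - x i)"
    by (intro continuous_on_coordinatewise_then_product continuous_intros
        continuous_on_product_then_coordinatewise[OF continuous_on_id])
  then have "continuous_on (convex hull X) (\<lambda>x. p - x)" by (simp add: fun_diff_def)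
  then have "continuous_on (convex hull X) (\<lambda>x. ip n (p - x) (p - x))"
    by (intro continuous_on_ip)
  then obtain z where z: "z \<in> convex hull X"
    "\<And>y. y \<in> convex hull X \<Longrightarrow> ip n (p - z) (p - z) \<le> ip n (p - y) (p - y)"
    using continuous_attains_inf[OF compact_convex_hull_finite[OF X(1)], of "\<lambda>x. ip n (p - x) (p - x)"] X(2)
    by (auto simp del: ip_simps)
  define \<theta> where "\<theta> = p - z"
  have hull: "convex hull X \<subseteq> euclidean_carrier n"
    by (intro hull_minimal X(3) subspace_imp_convex subspace_euclidean_carrier)
  have "0 < ip n \<theta> \<theta>"
  proof -
    have "\<exists>i<n. p i \<noteq> z i"
    proof (rule ccontr)
      assume "\<not> (\<exists>i<n. p i \<noteq> z i)"
      then have "p i = z i" for i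
        using p(1) z(1) hull by (cases "i < n") (auto simp: euclidean_carrier_iff)
      then show False using p(2) z(1) by (metis ext)
    qed
    then have "ip n \<theta> \<theta> \<noteq> 0" unfolding ip_self_eq_0_iff by (simp add: \<theta>_def)
    then show ?thesis using ip_self_nonneg[of n \<theta>] by linarith
  qed
  moreover have "ip n y \<theta> \<le> ip n z \<theta>" if y: "y \<in> convex hull X" for y
  proof (rule ccontr)
    assume "\<not> ?thesis"
    then have pos: "0 < ip n (y - z) \<theta>" by simp
    define w a b where "w = y - z" and "a = ip n w \<theta>" and "b = ip n w w"
    \<comment> \<open>Moving by \<open>t\<close> changes the squared distance by
      \<open>t * (t * b) - t * (2 * a)\<close>; this \<open>t\<close> makes it negative, and
      \<open>b + 1\<close> avoids a zero denominator.\<close>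
    define t where "t = min 1 (a / (b + 1))"
    have b0: "0 \<le> b" unfolding b_def by (rule ip_self_nonneg)
    have a0: "0 < a" using pos by (simp only: a_def w_def)
    have t: "0 < t" "t \<le> 1" using a0 b0 by (auto simp: t_def)
    have "t \<le> a / (b + 1)" by (simp add: t_def)
    then have "t * (b + 1) \<le> a" using b0 by (simp add: pos_le_divide_eq)
    then have "t * b < 2 * a" using t a0 by (simp add: algebra_simps)
    then have "t * (t * b) < t * (2 * a)" using t(1) by (rule mult_strict_left_mono)
    moreover have "(1 - t) *\<^sub>R z + t *\<^sub>R y \<in> convex hull X"
      using convexD[OF convex_convex_hull z(1) y, of "1 - t" t] t by simp
    then have "ip n \<theta> \<theta> \<le> ip n (p - ((1 - t) *\<^sub>R z + t *\<^sub>R y)) (p - ((1 - t) *\<^sub>R z + t *\<^sub>R y))"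
      unfolding \<theta>_def by (rule z(2))
    moreover have "p - ((1 - t) *\<^sub>R z + t *\<^sub>R y) = \<theta> - t *\<^sub>R w"
      by (simp add: \<theta>_def w_def fun_eq_iff algebra_simps)
    moreover have "ip n (\<theta> - t *\<^sub>R w) (\<theta> - t *\<^sub>R w) = ip n \<theta> \<theta> - t * (2 * a) + t * (t * b)"
      using ip_commute[of n \<theta> w] by (simp add: a_def b_def algebra_simps)
    ultimately show False by simp
  qed
  moreover have "ip n p \<theta> = ip n z \<theta> + ip n \<theta> \<theta>" by (simp add: \<theta>_def)
  ultimately have "ip n x \<theta> < ip n p \<theta>" if "x \<in> X" for x
    using hull_inc[OF that, of convex] by fastforce
  then show ?thesis by (rule that)
qed

text \<open>Support function duality: a point \<open>p\<close> outside the hull would be separated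
  by some \<open>\<theta>\<close>, but \<open>ip n p \<theta>\<close> is at most \<open>r\<close>
  times the length of \<open>\<theta>\<close>, a value reached on \<open>X\<close>.\<close>

lemma ball_in_convex_hull:
  fixes X :: "(nat \<Rightarrow> real) set"
  assumes X: "finite X" "X \<subseteq> euclidean_carrier n" and r: "0 \<le> r"
    and width: "\<And>\<theta>. \<exists>x\<in>X. r * sqrt (ip n \<theta> \<theta>) \<le> ip n x \<theta>"
    and p: "p \<in> euclidean_carrier n" "ip n p p \<le> r\<^sup>2"
  shows "p \<in> convex hull X"
proof (rule ccontr)
  assume "p \<notin> convex hull X"
  moreover have "X \<noteq> {}" using width by blast
  ultimately obtain \<theta> where \<theta>: "\<And>x. x \<in> X \<Longrightarrow> ip n x \<theta> < ip n p \<theta>"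
    using convex_hull_separation[OF X(1) _ X(2) p(1)] by blast
  have "\<bar>ip n p \<theta>\<bar> \<le> r * sqrt (ip n \<theta> \<theta>)"
    using r p by (intro ip_le_of_sq) simp_all
  then show False using width[of \<theta>] \<theta> by fastforce
qed

text \<open>More than \<open>n + 1\<close> points are affinely dependent; moving the convex
  coefficients along the dependence until one vanishes drops a point, contrary to the least
  cardinality of \<open>G\<close>.\<close>

lemma Caratheodory_carrier:
  fixes F :: "(nat \<Rightarrow> real) set"
  assumes F: "finite F" "F \<subseteq> euclidean_carrier n" and p: "p \<in> convex hull F"
  obtains G where "G \<subseteq> F" "card G \<le> n + 1" "p \<in> convex hull G"
proof -
  let ?P = "\<lambda>G. G \<subseteq> F \<and> p \<in> convex hull G"
  define G where "G = arg_min card ?P"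
  have G: "G \<subseteq> F" "p \<in> convex hull G" and min: "\<And>H. ?P H \<Longrightarrow> card G \<le> card H"
    using arg_min_nat_lemma[of ?P F card] p unfolding G_def by auto
  have fin: "finite G" using G(1) F(1) by (rule finite_subset)
  have "card G \<le> n + 1"
  proof (rule ccontr)
    assume big: "\<not> card G \<le> n + 1"
    then obtain a where a: "a \<in> G" by fastforce
    let ?D = "(\<lambda>x. - a + x) ` (G - {a})"
    have "card ?D = card G - 1" using a fin by (subst card_image) (auto simp: inj_on_def)
    moreover have "?D \<subseteq> span (unit_seq ` {..<n})"
      using a G(1) F(2) subspace_euclidean_carrier
      by (auto simp flip: euclidean_carrier_eq_span intro!: subspace_diff)
    moreover have "card (unit_seq ` {..<n}) = n" by (simp add: card_image inj_unit_seq)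
    ultimately have "dependent ?D"
      using independent_span_bound[of "unit_seq ` {..<n}" ?D] big by fastforce
    then have "affine_dependent G" using affine_dependent_iff_dependent2[OF a] by simp
    then obtain w where w: "sum w G = 0" "\<exists>v\<in>G. w v \<noteq> 0" "(\<Sum>v\<in>G. w v *\<^sub>R v) = 0"
      using affine_dependent_explicit_finite[OF fin] by blast
    obtain u where u: "\<And>x. x \<in> G \<Longrightarrow> 0 \<le> u x" "sum u G = 1" "(\<Sum>x\<in>G. u x *\<^sub>R x) = p"
      using G(2) convex_hull_finite[OF fin] by auto
    let ?N = "{v \<in> G. w v < 0}"
    have "?N \<noteq> {}"
    proof
      assume "?N = {}"
      then have "\<forall>v\<in>G. 0 \<le> w v" by force
      then have "\<forall>v\<in>G. w v = 0" using w(1) sum_nonneg_eq_0_iff[OF fin] by blast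
      then show False using w(2) by blast
    qed
    then obtain v where v: "v \<in> ?N" "\<And>x. x \<in> ?N \<Longrightarrow> u v / - w v \<le> u x / - w x"
      using fin ex_is_arg_min_if_finite[of ?N "\<lambda>x. u x / - w x"]
      by (auto simp: is_arg_min_linorder)
    \<comment> \<open>The least ratio over the negative \<open>w x\<close>: the coefficient of
      \<open>v\<close> reaches zero while the others stay nonnegative.\<close>
    define t where "t = u v / - w v"
    have t0: "0 \<le> t" using v(1) u(1)[of v] by (simp add: t_def divide_le_0_iff)
    define u' where "u' = (\<lambda>x. u x + t * w x)"
    have u'v: "u' v = 0" using v(1) by (simp add: u'_def t_def)
    have u'0: "0 \<le> u' x" if "x \<in> G" for x
    proof (cases "w x < 0")
      case True
      then have "t \<le> u x / - w x" using v(2)[of x] that by (simp add: t_def)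
      then show ?thesis using True by (simp add: u'_def field_simps)
    next
      case False
      then show ?thesis using u(1) that t0 by (simp add: u'_def)
    qed
    have vG: "v \<in> G" using v by simp
    have "sum u' (G - {v}) = 1"
      using sum.remove[OF fin vG, of u'] u'v u(2) w(1)
      by (simp add: u'_def sum.distrib flip: sum_distrib_left)
    moreover have "(\<Sum>x\<in>G - {v}. u' x *\<^sub>R x) = p"
    proof -
      have "(\<Sum>x\<in>G - {v}. u' x *\<^sub>R x) = (\<Sum>x\<in>G. u' x *\<^sub>R x)"
        using sum.remove[OF fin vG, of "\<lambda>x. u' x *\<^sub>R x"] u'v by simp
      also have "\<dots> = (\<Sum>x\<in>G. u x *\<^sub>R x) + t *\<^sub>R (\<Sum>x\<in>G. w x *\<^sub>R x)"
        unfolding u'_def scaleR_add_left sum.distrib scaleR_sum_right scaleR_scaleR ..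
      finally show ?thesis using u(3) w(3) by simp
    qed
    ultimately have "p \<in> convex hull (G - {v})"
      using convex_hull_finite[of "G - {v}"] fin u'0 by auto
    then have "card G \<le> card (G - {v})" using G(1) by (intro min) auto
    then show False using card_Diff1_less[OF fin vG] by simp
  qed
  then show ?thesis using that G by blast
qed

section \<open>Inscribed balls\<close>

text \<open>Each summand contributes \<open>(m - \<langle>u,\<theta>\<rangle>) * (t + \<langle>u,\<theta>\<rangle>) \<ge> 0\<close>.\<close>

lemma sum_sq_ip_le:
  assumes "\<And>u. u \<in> set us \<Longrightarrow> ip n u \<theta> \<le> m" "\<And>u. u \<in> set us \<Longrightarrow> - t \<le> ip n u \<theta>"
  shows "(\<Sum>u\<leftarrow>us. (ip n u \<theta>)\<^sup>2) \<le> real (length us) * m * t + (m - t) * ip n (sum_list us) \<theta>"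
  using assms
proof (induction us)
  case (Cons u us)
  have "sum_list (u # us) = u + sum_list us" by simp
  then have "ip n (sum_list (u # us)) \<theta> = ip n (u + sum_list us) \<theta>" by (rule arg_cong)
  then have s: "ip n (sum_list (u # us)) \<theta> = ip n u \<theta> + ip n (sum_list us) \<theta>" by simp
  have "0 \<le> (m - ip n u \<theta>) * (t + ip n u \<theta>)"
    using Cons.prems(1)[of u] Cons.prems(2)[of u] by (intro mult_nonneg_nonneg) simp_all
  moreover have "(\<Sum>u\<leftarrow>us. (ip n u \<theta>)\<^sup>2) \<le> real (length us) * m * t + (m - t) * ip n (sum_list us) \<theta>"
    by (rule Cons.IH) (use Cons.prems in simp_all)
  ultimately show ?case unfolding s by (simp add: algebra_simps power2_eq_square)
qed (simp add: ip_def)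

text \<open>With order n^2 points the lower bound \<open>K\<close> outweighs the bias of their sum.
  The resulting ball supplies the balancing points for the sparser selection.\<close>

lemma isotropic_dual_spread:
  assumes S: "isotropic_dual n S" and n: "1 \<le> n" and SV: "S \<subseteq> euclidean_carrier n"
  obtains F where "finite F" "F \<subseteq> S"
    "\<And>p. p \<in> euclidean_carrier n \<Longrightarrow> ip n p p \<le> (1 / (81 * real n))\<^sup>2 \<Longrightarrow> p \<in> convex hull F"
proof -
  \<comment> \<open>With N = 40 n K this \<open>K\<close> gives 20 N = (K / 2)^2, so the sum has
    length at most K / 2. Failure of the width bound then forces K / 2 <= N r, that is r >= 1 / (80
    n), which the constant 81 excludes.\<close>
  define K where "K = 3200 * real n"
  define N where "N = 128000 * n * n"
  have N: "40 * real n * K = real N" by (simp add: K_def N_def)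
  have n0: "1 \<le> real n" using n by simp
  obtain us where us: "length us = N" "set us \<subseteq> S"
    "\<And>x. K * ip n x x \<le> (\<Sum>u\<leftarrow>us. (ip n u x)\<^sup>2)"
    "ip n (sum_list us) (sum_list us) \<le> 20 * real N"
    using greedy_contact_points[OF S n, of K N] n N by (auto simp: K_def)
  let ?s = "sum_list us"
  define r where "r = 1 / (81 * real n)"
  have r: "0 < r" "r \<le> 1" using n0 by (simp_all add: r_def)
  have width: "\<exists>x\<in>set us. r * sqrt (ip n \<theta> \<theta>) \<le> ip n x \<theta>" for \<theta>
  proof (rule ccontr)
    define t where "t = sqrt (ip n \<theta> \<theta>)"
    have t0: "0 \<le> t" and t2: "ip n \<theta> \<theta> = t\<^sup>2" by (simp_all add: t_def)
    assume "\<not> ?thesis"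
    then have less: "\<And>u. u \<in> set us \<Longrightarrow> ip n u \<theta> < r * t" by (auto simp: t_def not_le)
    have abs: "\<bar>ip n u \<theta>\<bar> \<le> t" if "u \<in> set us" for u
      using ip_le_of_sq[of n u 1 \<theta> t] that S us(2) t2 t0 by (auto simp: isotropic_dual_def)
    have "us \<noteq> []" using us(1) n by (auto simp: N_def)
    then obtain u where u: "u \<in> set us" by fastforce
    have "t \<noteq> 0" using less[OF u] abs[OF u] by auto
    then have t: "0 < t" using t0 by simp
    have "20 * real N \<le> (K / 2)\<^sup>2" by (simp add: K_def N_def power2_eq_square)
    then have s: "\<bar>ip n ?s \<theta>\<bar> \<le> K / 2 * t"
      using us(4) t0 t2 by (intro ip_le_of_sq) (auto simp: K_def)
    have "K * t\<^sup>2 \<le> real N * (r * t) * t + (r * t - t) * ip n ?s \<theta>"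
      using us(3)[of \<theta>] sum_sq_ip_le[of us n \<theta> "r * t" t] less abs
      unfolding t2 us(1) by (smt (verit, ccfv_threshold))
    also have "(r * t - t) * ip n ?s \<theta> \<le> t * (K / 2 * t)"
    proof -
      have "(r * t - t) * ip n ?s \<theta> \<le> \<bar>r * t - t\<bar> * \<bar>ip n ?s \<theta>\<bar>" by (metis abs_ge_self abs_mult)
      also have "\<dots> \<le> t * (K / 2 * t)"
      proof (rule mult_mono)
        have "r * t \<le> 1 * t" using r t0 by (intro mult_right_mono)
        moreover have "0 \<le> r * t" using r t0 by simp
        ultimately show "\<bar>r * t - t\<bar> \<le> t" by simp
      qed (use s t0 in simp_all)
      finally show ?thesis .
    qed
    finally have "K / 2 * t\<^sup>2 \<le> (real N * r) * t\<^sup>2" by (simp add: power2_eq_square algebra_simps)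
    then have "K / 2 \<le> real N * r" using t by simp
    then show False using n0 by (simp add: N[symmetric] K_def r_def field_simps)
  qed
  have "p \<in> convex hull (set us)" if "p \<in> euclidean_carrier n" "ip n p p \<le> (1 / (81 * real n))\<^sup>2" for p
    using ball_in_convex_hull[of "set us" n r p] width that us(2) SV r by (auto simp: r_def)
  then show ?thesis using that us(2) by blast
qed

text \<open>Here \<open>K\<close> need not dominate the sum s, so s is balanced: -s / (81 n |s|)
  lies in the hull of \<open>G\<close>, and an upper bound \<open>m\<close> on \<open>G\<close> in
  direction \<open>\<theta>\<close> bounds -<s, \<theta>> by 81 n |s| m. In
  \<open>sum_sq_ip_le\<close> this would give K <= r (N + 82 n |s|), which the choice of
  \<open>r\<close> excludes.\<close>

lemma isotropic_dual_few_points: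
  assumes S: "isotropic_dual n S" and n: "1 \<le> n" and SV: "S \<subseteq> euclidean_carrier n"
    and K: "1 \<le> K" "K \<le> real n"
  obtains X where "finite X" "X \<subseteq> S" "real (card X) \<le> 43 * real n * K"
    "\<And>p. p \<in> euclidean_carrier n \<Longrightarrow> ip n p p \<le> (sqrt K / (2500 * real n * sqrt (real n)))\<^sup>2
      \<Longrightarrow> p \<in> convex hull X"
proof -
  have n0: "1 \<le> real n" using n by simp
  have nK: "1 \<le> real n * K" using mult_mono[of 1 "real n" 1 K] n0 K by simp
  define N where "N = nat \<lceil>40 * real n * K\<rceil>"
  have N: "40 * real n * K \<le> real N" "real N \<le> 41 * (real n * K)"
    using nK K n0 by (simp_all add: N_def) linarith+
  obtain us where us: "length us = N" "set us \<subseteq> S"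
    "\<And>x. K * ip n x x \<le> (\<Sum>u\<leftarrow>us. (ip n u x)\<^sup>2)"
    "ip n (sum_list us) (sum_list us) \<le> 20 * real N"
    using greedy_contact_points[OF S n K(1) N(1)] by blast
  let ?s = "sum_list us"
  define \<sigma> where "\<sigma> = sqrt (ip n ?s ?s)"
  have \<sigma>0: "0 \<le> \<sigma>" and \<sigma>2: "ip n ?s ?s = \<sigma>\<^sup>2" by (simp_all add: \<sigma>_def)
  have sV: "?s \<in> euclidean_carrier n"
  proof -
    have "set us \<subseteq> euclidean_carrier n" using us(2) SV by blast
    then have "sum_list us i = 0" if "n \<le> i" for i
      using sum_list_fun_apply[of "\<lambda>u. u" us i] that
      by (auto simp: euclidean_carrier_iff subset_iff intro!: sum_list_0[THEN trans[rotated]] arg_cong[where f = sum_list] map_cong)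
    then show ?thesis by (simp add: euclidean_carrier_iff)
  qed
  obtain F where F: "finite F" "F \<subseteq> S"
    "\<And>p. p \<in> euclidean_carrier n \<Longrightarrow> ip n p p \<le> (1 / (81 * real n))\<^sup>2 \<Longrightarrow> p \<in> convex hull F"
    using isotropic_dual_spread[OF S n SV] by blast
  obtain G where G: "G \<subseteq> F" "card G \<le> n + 1"
    and bal: "\<And>\<theta> m. (\<And>x. x \<in> G \<Longrightarrow> ip n x \<theta> \<le> m) \<Longrightarrow> 0 \<le> m \<Longrightarrow> - ip n ?s \<theta> \<le> 81 * real n * \<sigma> * m"
  proof (cases "\<sigma> = 0")
    case True
    have "ip n ?s \<theta> = 0" for \<theta>
      using ip_Cauchy_Schwarz[of n ?s \<theta>] True unfolding \<sigma>2 by simp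
    then show ?thesis using that[of "{}"] True by simp
  next
    case False
    then have \<sigma>: "0 < \<sigma>" using \<sigma>0 by simp
    define a where "a = 1 / (81 * real n * \<sigma>)"
    have a0: "0 < a" using \<sigma> n0 by (simp add: a_def)
    have "(- a) *\<^sub>R ?s \<in> convex hull F"
    proof (rule F(3))
      show "(- a) *\<^sub>R ?s \<in> euclidean_carrier n"
        by (rule subspace_scale[OF subspace_euclidean_carrier sV])
      have "ip n ((- a) *\<^sub>R ?s) ((- a) *\<^sub>R ?s) = a\<^sup>2 * ip n ?s ?s"
        by (simp add: power2_eq_square)
      also have "\<dots> = (1 / (81 * real n))\<^sup>2"
        unfolding \<sigma>2 a_def using \<sigma> by (simp add: power_divide power_mult_distrib)
      finally show "ip n ((- a) *\<^sub>R ?s) ((- a) *\<^sub>R ?s) \<le> (1 / (81 * real n))\<^sup>2" by simp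
    qed
    then obtain G where G: "G \<subseteq> F" "card G \<le> n + 1" "(- a) *\<^sub>R ?s \<in> convex hull G"
      using Caratheodory_carrier[of F n] F(1,2) SV by (metis subset_trans)
    have "- ip n ?s \<theta> \<le> 81 * real n * \<sigma> * m" if "\<And>x. x \<in> G \<Longrightarrow> ip n x \<theta> \<le> m" for \<theta> m
    proof -
      have "convex {x. ip n x \<theta> \<le> m}"
        unfolding convex_def using convex_bound_le[of _ m] by auto
      then have "convex hull G \<subseteq> {x. ip n x \<theta> \<le> m}" using that by (intro hull_minimal) auto
      then have "ip n ((- a) *\<^sub>R ?s) \<theta> \<le> m" using G(3) by blast
      then have "a * - ip n ?s \<theta> \<le> m" by simp
      then show ?thesis using \<sigma> n0 by (simp add: a_def field_simps)
    qed
    then show ?thesis using that G by blast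
  qed
  define X where "X = set us \<union> G"
  have finX: "finite X" and XS: "X \<subseteq> S"
    using G(1) F(1,2) us(2) by (auto simp: X_def intro: finite_subset)
  have "card X \<le> card (set us) + card G" unfolding X_def by (rule card_Un_le)
  then have "real (card X) \<le> real N + (real n + 1)"
    using card_length[of us] us(1) G(2) by linarith
  moreover have "real n \<le> real n * K" using K n0 by simp
  ultimately have cardX: "real (card X) \<le> 43 * real n * K" using N(2) nK by simp
  define r where "r = sqrt K / (2500 * real n * sqrt (real n))"
  have r: "0 < r" using K n0 by (simp add: r_def)
  \<comment> \<open>|s|^2 <= 820 n K gives |s| <= 29 sqrt (n K), and \<open>K \<le> n\<close> gives
    K <= sqrt (n K); the total 41 + 82 * 29 = 2419 is below 2500.\<close>
  have key: "r * (real N + 82 * real n * \<sigma>) < K"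
  proof -
    let ?k = "sqrt K" and ?q = "sqrt (real n)"
    have k: "1 \<le> ?k" "?k \<le> ?q" "?k * ?k = K" "1 \<le> ?q" "?q * ?q = real n"
      using K n0 by simp_all
    have "\<sigma> \<le> 29 * (?q * ?k)"
    proof (rule power2_le_imp_le)
      have "\<sigma>\<^sup>2 \<le> 820 * (real n * K)" using us(4) N(2) unfolding \<sigma>2 by simp
      also have "\<dots> \<le> (29 * (?q * ?k))\<^sup>2" using K n0 by (simp add: power_mult_distrib)
      finally show "\<sigma>\<^sup>2 \<le> (29 * (?q * ?k))\<^sup>2" .
    qed (use k in simp)
    then have "82 * real n * \<sigma> \<le> 82 * real n * (29 * (?q * ?k))" using n0 by (intro mult_left_mono) simp_all
    then have "82 * real n * \<sigma> \<le> 2378 * (real n * (?q * ?k))" by (simp only: mult_ac)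
    moreover have "real N \<le> 41 * (real n * (?q * ?k))"
    proof -
      have "K \<le> ?q * ?k" using k mult_right_mono[of ?k ?q ?k] by simp
      then have "real n * K \<le> real n * (?q * ?k)" using n0 by (intro mult_left_mono) simp_all
      then show ?thesis using N(2) by linarith
    qed
    moreover have pos: "0 < real n * (?q * ?k)" using n0 K by simp
    ultimately have "real N + 82 * real n * \<sigma> < 2500 * (real n * (?q * ?k))" by linarith
    then have "r * (real N + 82 * real n * \<sigma>) < r * (2500 * (real n * (?q * ?k)))"
      using r by (intro mult_strict_left_mono)
    also have "\<dots> = ?k * ?k" using n0 by (simp add: r_def field_simps)
    finally show ?thesis using k(3) by simp
  qed
  have width: "\<exists>x\<in>X. r * sqrt (ip n \<theta> \<theta>) \<le> ip n x \<theta>" for \<theta>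
  proof (rule ccontr)
    define t where "t = sqrt (ip n \<theta> \<theta>)"
    have t0: "0 \<le> t" and t2: "ip n \<theta> \<theta> = t\<^sup>2" by (simp_all add: t_def)
    assume "\<not> ?thesis"
    then have less: "\<And>u. u \<in> X \<Longrightarrow> ip n u \<theta> < r * t" by (auto simp: t_def not_le)
    have abs: "\<bar>ip n u \<theta>\<bar> \<le> t" if "u \<in> X" for u
      using ip_le_of_sq[of n u 1 \<theta> t] that S XS t2 t0 by (auto simp: isotropic_dual_def)
    have "0 < real N" using N(1) nK by linarith
    then have "hd us \<in> X" using us(1) by (auto simp: X_def)
    then obtain u where u: "u \<in> X" by blast
    have "t \<noteq> 0" using less[OF u] abs[OF u] by auto
    then have t: "0 < t" using t0 by simp
    have m0: "0 \<le> r * t" using r t0 by simp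
    have s1: "\<bar>ip n ?s \<theta>\<bar> \<le> \<sigma> * t"
      using \<sigma>0 \<sigma>2 t0 t2 by (intro ip_le_of_sq) auto
    have s2: "- ip n ?s \<theta> \<le> 81 * real n * \<sigma> * (r * t)"
      using less m0 by (intro bal) (auto simp: X_def intro: less_imp_le)
    have "K * t\<^sup>2 \<le> real N * (r * t) * t + (r * t - t) * ip n ?s \<theta>"
      using us(3)[of \<theta>] sum_sq_ip_le[of us n \<theta> "r * t" t] less abs
      unfolding t2 us(1) X_def by (smt (verit, ccfv_threshold) UnI1)
    also have "\<dots> = real N * (r * t) * t + (r * t) * ip n ?s \<theta> + t * (- ip n ?s \<theta>)"
      by (simp add: algebra_simps)
    also have "\<dots> \<le> real N * (r * t) * t + (r * t) * (\<sigma> * t) + t * (81 * real n * \<sigma> * (r * t))"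
      using s1 s2 m0 t0 by (intro add_mono mult_left_mono) auto
    also have "\<dots> = r * (real N + \<sigma> + 81 * real n * \<sigma>) * t\<^sup>2"
      by (simp add: power2_eq_square algebra_simps)
    also have "\<dots> \<le> r * (real N + 82 * real n * \<sigma>) * t\<^sup>2"
    proof -
      have "\<sigma> \<le> real n * \<sigma>" using n0 \<sigma>0 mult_right_mono[of 1 "real n" \<sigma>] by simp
      then show ?thesis using r by (intro mult_right_mono mult_left_mono) (auto simp: mult.commute)
    qed
    finally have "K \<le> r * (real N + 82 * real n * \<sigma>)" using t by simp
    then show False using key by simp
  qed
  have "p \<in> convex hull X" if "p \<in> euclidean_carrier n" "ip n p p \<le> r\<^sup>2" for p
    using ball_in_convex_hull[of X n r p] width that finX XS SV r by auto
  then show ?thesis using that[OF finX XS cardX] by (simp add: r_def)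
qed

section \<open>Volume of triangular ellipsoids\<close>

abbreviation lborel_prod :: "nat \<Rightarrow> (nat \<Rightarrow> real) measure"
  where "lborel_prod n \<equiv> \<Pi>\<^sub>M i\<in>{..<n}. lborel"

text \<open>Lower triangular affine maps are enough for the volume comparison, and their change of
  variables reduces to integration on the line.\<close>

definition triangular_map :: "(nat \<Rightarrow> real) \<Rightarrow> (nat \<Rightarrow> nat \<Rightarrow> real) \<Rightarrow> (nat \<Rightarrow> real) \<Rightarrow> (nat \<Rightarrow> real) \<Rightarrow> nat \<Rightarrow> real"
  where "triangular_map a L h x = (\<lambda>i. a i * x i + (\<Sum>j<i. L i j * x j) + h i)"

lemma measurable_triangular_map:
  "(\<lambda>x. restrict (triangular_map a L h x) {..<n}) \<in> measurable (lborel_prod n) (lborel_prod n)"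
proof (rule measurable_restrict)
  fix i assume i: "i \<in> {..<n}"
  have comp: "(\<lambda>x. x j) \<in> borel_measurable (lborel_prod n)" if "j \<le> i" for j
    using measurable_component_singleton[of j "{..<n}" "\<lambda>_. lborel"] that i by simp
  have "(\<lambda>x. a i * x i + (\<Sum>j<i. L i j * x j) + h i) \<in> borel_measurable (lborel_prod n)"
    by (intro borel_measurable_add borel_measurable_sum borel_measurable_times borel_measurable_const comp) auto
  then show "(\<lambda>x. triangular_map a L h x i) \<in> measurable (lborel_prod n) lborel"
    by (simp add: triangular_map_def)
qed

text \<open>With the first \<open>n\<close> coordinates fixed, the last is scaled by
  \<open>a n\<close> and translated, so Fubini and the affine rule on the line carry the induction;
  the product of the diagonal is the determinant.\<close>

lemma nn_integral_triangular_map: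
  assumes "\<And>i. i < n \<Longrightarrow> a i \<noteq> 0" and "f \<in> borel_measurable (lborel_prod n)"
  shows "(\<integral>\<^sup>+x. f x \<partial>lborel_prod n)
    = (\<Prod>i<n. ennreal \<bar>a i\<bar>) * (\<integral>\<^sup>+x. f (restrict (triangular_map a L h x) {..<n}) \<partial>lborel_prod n)"
  using assms
proof (induction n arbitrary: f)
  case 0
  then show ?case by (simp add: PiM_empty nn_integral_count_space_finite)
next
  case (Suc n)
  interpret product_sigma_finite "\<lambda>_ :: nat. lborel :: real measure" by standard
  let ?T = "\<lambda>n x. restrict (triangular_map a L h x) {..<n}"
  have f: "f \<in> borel_measurable (Pi\<^sub>M (insert n {..<n}) (\<lambda>_. lborel))"
    using Suc.prems(2) by (simp add: lessThan_Suc)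
  have fT: "(\<lambda>x. f (?T (Suc n) x)) \<in> borel_measurable (Pi\<^sub>M (insert n {..<n}) (\<lambda>_. lborel))"
    unfolding lessThan_Suc[symmetric]
    by (rule measurable_compose[OF measurable_triangular_map Suc.prems(2)])
  define g where "g = (\<lambda>x. \<integral>\<^sup>+y. f (x(n := y)) \<partial>lborel)"
  have upd: "(\<lambda>(x, y). f (x(n := y))) \<in> borel_measurable (lborel_prod n \<Otimes>\<^sub>M lborel)"
    using measurable_compose[OF measurable_add_dim f] by (simp add: case_prod_beta)
  have g: "g \<in> borel_measurable (lborel_prod n)"
    unfolding g_def by (rule lborel.borel_measurable_nn_integral[OF upd])
  have inner: "g (?T n x) = ennreal \<bar>a n\<bar> * (\<integral>\<^sup>+y. f (?T (Suc n) (x(n := y))) \<partial>lborel)"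
    if x: "x \<in> space (lborel_prod n)" for x
  proof -
    have "?T n x \<in> space (lborel_prod n)" using measurable_space[OF measurable_triangular_map x] .
    then have "(\<lambda>y. (?T n x)(n := y)) \<in> measurable lborel (Pi\<^sub>M (insert n {..<n}) (\<lambda>_. lborel))"
      by (rule measurable_component_update) simp
    from measurable_compose[OF this f] have "(\<lambda>y. f ((?T n x)(n := y))) \<in> borel_measurable borel" by simp
    then have "g (?T n x) = ennreal \<bar>a n\<bar> *
        (\<integral>\<^sup>+y. f ((?T n x)(n := ((\<Sum>j<n. L n j * x j) + h n) + a n * y)) \<partial>lborel)"
      unfolding g_def using Suc.prems(1)[of n] by (intro nn_integral_real_affine) auto
    moreover have "(?T n x)(n := ((\<Sum>j<n. L n j * x j) + h n) + a n * y) = ?T (Suc n) (x(n := y))" for y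
      by (auto simp: fun_eq_iff restrict_def triangular_map_def less_Suc_eq intro!: sum.cong)
    ultimately show ?thesis by (simp only:)
  qed
  have "(\<integral>\<^sup>+x. f x \<partial>lborel_prod (Suc n)) = (\<integral>\<^sup>+x. g x \<partial>lborel_prod n)"
    unfolding g_def lessThan_Suc by (rule product_nn_integral_insert) (use f in auto)
  also have "\<dots> = (\<Prod>i<n. ennreal \<bar>a i\<bar>) * (\<integral>\<^sup>+x. g (?T n x) \<partial>lborel_prod n)"
    using Suc.prems(1) by (intro Suc.IH g) simp
  also have "(\<integral>\<^sup>+x. g (?T n x) \<partial>lborel_prod n)
      = (\<integral>\<^sup>+x. ennreal \<bar>a n\<bar> * (\<integral>\<^sup>+y. f (?T (Suc n) (x(n := y))) \<partial>lborel) \<partial>lborel_prod n)"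
    by (intro nn_integral_cong inner)
  also have "\<dots> = ennreal \<bar>a n\<bar> * (\<integral>\<^sup>+x. (\<integral>\<^sup>+y. f (?T (Suc n) (x(n := y))) \<partial>lborel) \<partial>lborel_prod n)"
  proof (rule nn_integral_cmult)
    have "(\<lambda>(x, y). f (?T (Suc n) (x(n := y)))) \<in> borel_measurable (lborel_prod n \<Otimes>\<^sub>M lborel)"
      using measurable_compose[OF measurable_add_dim fT] by (simp add: case_prod_beta)
    then show "(\<lambda>x. \<integral>\<^sup>+y. f (?T (Suc n) (x(n := y))) \<partial>lborel) \<in> borel_measurable (lborel_prod n)"
      by (rule lborel.borel_measurable_nn_integral)
  qed
  also have "(\<integral>\<^sup>+x. (\<integral>\<^sup>+y. f (?T (Suc n) (x(n := y))) \<partial>lborel) \<partial>lborel_prod n)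
      = (\<integral>\<^sup>+x. f (?T (Suc n) x) \<partial>lborel_prod (Suc n))"
    unfolding lessThan_Suc[of n] by (rule product_nn_integral_insert[symmetric]) (use fT in \<open>auto simp: lessThan_Suc\<close>)
  finally show ?case by (simp only: prod.lessThan_Suc mult.assoc)
qed

section \<open>Triangular ellipsoids and their volumes\<close>

lemma L2_set_le_1_iff: "L2_set x {..<n} \<le> 1 \<longleftrightarrow> ip n x x \<le> 1"
  by (simp add: L2_set_def ip_def power2_eq_square)

lemma euclidean_unit_ball_iff: "x \<in> euclidean_unit_ball n \<longleftrightarrow> x \<in> euclidean_carrier n \<and> ip n x x \<le> 1"
  by (simp add: euclidean_unit_ball_def L2_set_le_1_iff)

lemma euclidean_unit_sphere_iff: "x \<in> euclidean_unit_sphere n \<longleftrightarrow> x \<in> euclidean_carrier n \<and> ip n x x = 1"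
  by (simp add: euclidean_unit_sphere_def L2_set_def ip_def power2_eq_square)

lemma closed_euclidean_carrier: "closed (euclidean_carrier n)"
proof -
  have "euclidean_carrier n = (\<Inter>i\<in>{n..}. {x. x i = 0})" by (auto simp: euclidean_carrier_iff)
  moreover have "closed {x :: nat \<Rightarrow> real. x i = 0}" for i
    by (intro closed_Collect_eq continuous_on_product_coordinates continuous_on_const)
  ultimately show ?thesis by (simp add: closed_INT)
qed

lemma continuous_on_triangular_map: "continuous_on A (\<lambda>x. triangular_map a L h x)"
  unfolding triangular_map_def
  by (intro continuous_on_coordinatewise_then_product continuous_on_add continuous_on_sum continuous_on_mult
      continuous_on_const continuous_on_product_then_coordinatewise[OF continuous_on_id])

text \<open>A preimage of the ball rather than an image: containment of \<open>K\<close> becomes an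
  inequality on the points of \<open>K\<close>, and a determinant above 1 shrinks the
  volume.\<close>

definition triangular_ellipsoid :: "nat \<Rightarrow> (nat \<Rightarrow> real) \<Rightarrow> (nat \<Rightarrow> nat \<Rightarrow> real) \<Rightarrow> (nat \<Rightarrow> real) \<Rightarrow> (nat \<Rightarrow> real) set"
  where "triangular_ellipsoid n a L h =
    {x \<in> euclidean_carrier n. ip n (triangular_map a L h x) (triangular_map a L h x) \<le> 1}"

lemma triangular_ellipsoid_borel: "triangular_ellipsoid n a L h \<in> sets borel"
proof -
  have "closed {x. ip n (triangular_map a L h x) (triangular_map a L h x) \<le> 1}"
    by (intro closed_Collect_le continuous_on_ip continuous_on_triangular_map continuous_on_const)
  then have "closed (euclidean_carrier n \<inter> {x. ip n (triangular_map a L h x) (triangular_map a L h x) \<le> 1})"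
    by (intro closed_Int closed_euclidean_carrier)
  then show ?thesis by (simp add: triangular_ellipsoid_def Collect_conj_eq borel_closed)
qed

lemma euclidean_unit_ball_eq_triangular:
  "euclidean_unit_ball n = triangular_ellipsoid n (\<lambda>_. 1) (\<lambda>_ _. 0) (\<lambda>_. 0)"
  by (auto simp: euclidean_unit_ball_iff triangular_ellipsoid_def triangular_map_def)

lemma emeasure_triangular_ellipsoid:
  "emeasure (euclidean_lborel n) (triangular_ellipsoid n a L h) =
    (\<integral>\<^sup>+x. indicator {x. ip n x x \<le> 1} (restrict (triangular_map a L h x) {..<n}) \<partial>lborel_prod n)"
proof -
  let ?e = "\<lambda>x i. if i < n then x i else (0::real)"
  have "emeasure (euclidean_lborel n) (triangular_ellipsoid n a L h)
    = emeasure (lborel_prod n) (?e -` triangular_ellipsoid n a L h \<inter> space (lborel_prod n))"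
    unfolding euclidean_lborel_def
    by (rule emeasure_distr[OF measurable_euclidean_lborel triangular_ellipsoid_borel])
  also have "\<dots> = (\<integral>\<^sup>+x. indicator (?e -` triangular_ellipsoid n a L h \<inter> space (lborel_prod n)) x \<partial>lborel_prod n)"
    by (rule nn_integral_indicator[symmetric])
      (rule measurable_sets[OF measurable_euclidean_lborel triangular_ellipsoid_borel])
  also have "\<dots> = (\<integral>\<^sup>+x. indicator {x. ip n x x \<le> 1} (restrict (triangular_map a L h x) {..<n}) \<partial>lborel_prod n)"
  proof (rule nn_integral_cong)
    fix x assume x: "x \<in> space (lborel_prod n)"
    have "ip n (triangular_map a L h (?e x)) (triangular_map a L h (?e x)) =
        ip n (restrict (triangular_map a L h x) {..<n}) (restrict (triangular_map a L h x) {..<n})"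
      by (rule ip_cong) (auto simp: triangular_map_def intro!: sum.cong)
    then show "indicator (?e -` triangular_ellipsoid n a L h \<inter> space (lborel_prod n)) x =
        (indicator {x. ip n x x \<le> 1} (restrict (triangular_map a L h x) {..<n}) :: ennreal)"
      using x by (auto simp: indicator_def triangular_ellipsoid_def euclidean_carrier_iff)
  qed
  finally show ?thesis .
qed

lemma sets_ball_lborel_prod: "{x \<in> space (lborel_prod n). ip n x x \<le> 1} \<in> sets (lborel_prod n)"
proof -
  have "(\<lambda>x. ip n x x) \<in> borel_measurable (lborel_prod n)"
    unfolding ip_def
    by (intro borel_measurable_sum borel_measurable_times)
      (use measurable_component_singleton[of _ "{..<n}" "\<lambda>_. lborel :: real measure"] in auto)
  then show ?thesis by simp
qed

lemma emeasure_unit_ball_eq: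
  assumes "\<And>i. i < n \<Longrightarrow> a i \<noteq> 0"
  shows "emeasure (euclidean_lborel n) (euclidean_unit_ball n) =
    (\<Prod>i<n. ennreal \<bar>a i\<bar>) * emeasure (euclidean_lborel n) (triangular_ellipsoid n a L h)"
proof -
  let ?I = "indicator {x. ip n x x \<le> 1} :: (nat \<Rightarrow> real) \<Rightarrow> ennreal"
  have "(indicator {x \<in> space (lborel_prod n). ip n x x \<le> 1} :: (nat \<Rightarrow> real) \<Rightarrow> ennreal)
      \<in> borel_measurable (lborel_prod n)"
    using sets_ball_lborel_prod by (rule borel_measurable_indicator)
  then have I: "?I \<in> borel_measurable (lborel_prod n)"
    by (rule measurable_cong[THEN iffD1, rotated]) (auto simp: indicator_def)
  have "(\<integral>\<^sup>+x. ?I x \<partial>lborel_prod n) = 1 * emeasure (euclidean_lborel n) (euclidean_unit_ball n)"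
    unfolding euclidean_unit_ball_eq_triangular emeasure_triangular_ellipsoid
    by (subst nn_integral_triangular_map[OF _ I, where a = "\<lambda>_. 1"]) auto
  moreover have "(\<integral>\<^sup>+x. ?I x \<partial>lborel_prod n)
      = (\<Prod>i<n. ennreal \<bar>a i\<bar>) * emeasure (euclidean_lborel n) (triangular_ellipsoid n a L h)"
    unfolding emeasure_triangular_ellipsoid by (rule nn_integral_triangular_map[OF assms I])
  ultimately show ?thesis by simp
qed

text \<open>The ball lies between the cubes of half-side \<open>1 / n\<close> and \<open>1\<close>.
  Both bounds serve to derive a contradiction from a volume ratio above 1.\<close>

lemma emeasure_unit_ball_pos_finite:
  assumes n: "1 \<le> n"
  shows "0 < emeasure (euclidean_lborel n) (euclidean_unit_ball n)"
    and "emeasure (euclidean_lborel n) (euclidean_unit_ball n) < \<infinity>"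
proof -
  interpret product_sigma_finite "\<lambda>_ :: nat. lborel :: real measure" by standard
  let ?B = "{x \<in> space (lborel_prod n). ip n x x \<le> 1}"
  have eq: "emeasure (euclidean_lborel n) (euclidean_unit_ball n) = emeasure (lborel_prod n) ?B"
  proof -
    have "emeasure (euclidean_lborel n) (euclidean_unit_ball n)
      = (\<integral>\<^sup>+x. indicator ?B x \<partial>lborel_prod n)"
      unfolding euclidean_unit_ball_eq_triangular emeasure_triangular_ellipsoid
    proof (rule nn_integral_cong)
      fix x assume x: "x \<in> space (lborel_prod n)"
      then have "restrict (triangular_map (\<lambda>_. 1) (\<lambda>_ _. 0) (\<lambda>_. 0) x) {..<n} = x"
        by (auto simp: triangular_map_def space_PiM PiE_def extensional_def restrict_def)
      then show "indicator {x. ip n x x \<le> 1} (restrict (triangular_map (\<lambda>_. 1) (\<lambda>_ _. 0) (\<lambda>_. 0) x) {..<n})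
          = (indicator ?B x :: ennreal)"
        using x by (simp add: indicator_def)
    qed
    also have "\<dots> = emeasure (lborel_prod n) ?B" by (rule nn_integral_indicator[OF sets_ball_lborel_prod])
    finally show ?thesis .
  qed
  have n0: "0 < real n" using n by simp
  let ?c = "\<lambda>r :: real. Pi\<^sub>E {..<n} (\<lambda>_. {-r..r})"
  have cube: "emeasure (lborel_prod n) (?c r) = ennreal (2 * r) ^ n" if "0 \<le> r" for r
    using that by (subst emeasure_PiM) auto
  have "?c (1 / real n) \<subseteq> ?B"
  proof
    fix x assume x: "x \<in> ?c (1 / real n)"
    have "ip n x x \<le> (\<Sum>i<n. 1 / real n)"
      unfolding ip_def
    proof (rule sum_mono)
      fix i assume "i \<in> {..<n}"
      then have "x i \<in> {- (1 / real n)..1 / real n}" by (rule PiE_mem[OF x])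
      then have "\<bar>x i\<bar> \<le> 1 / real n" unfolding atLeastAtMost_iff abs_le_iff by linarith
      moreover have "1 / real n \<le> 1" using n by simp
      ultimately have "\<bar>x i\<bar> * \<bar>x i\<bar> \<le> 1 / real n * 1" by (intro mult_mono) auto
      then show "x i * x i \<le> 1 / real n" by simp
    qed
    also have "\<dots> = 1" using n0 by simp
    finally show "x \<in> ?B" using x by (auto simp: space_PiM PiE_iff)
  qed
  then have "emeasure (lborel_prod n) (?c (1 / real n)) \<le> emeasure (lborel_prod n) ?B"
    by (rule emeasure_mono[OF _ sets_ball_lborel_prod])
  moreover have "0 < ennreal (2 * (1 / real n)) ^ n"
    using n0 by (simp add: ennreal_power zero_less_power)
  ultimately show "0 < emeasure (euclidean_lborel n) (euclidean_unit_ball n)"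
    unfolding eq using cube[of "1 / real n"] n0 by (simp add: less_le_trans)
  have "?B \<subseteq> ?c 1"
  proof
    fix x assume x: "x \<in> ?B"
    have "x i \<in> {-1..1}" if "i < n" for i
    proof -
      have "x i * x i \<le> ip n x x" unfolding ip_def by (rule member_le_sum) (use that in auto)
      then have "(x i)\<^sup>2 \<le> 1" using x by (simp add: power2_eq_square)
      then show ?thesis by (simp add: abs_square_le_1 abs_le_iff)
    qed
    then show "x \<in> ?c 1" using x by (auto simp: space_PiM PiE_iff)
  qed
  then have "emeasure (lborel_prod n) ?B \<le> emeasure (lborel_prod n) (?c 1)"
    by (rule emeasure_mono) (auto intro!: sets_PiM_I_finite)
  also have "\<dots> < \<infinity>" using cube[of 1] by (simp add: power_less_top_ennreal)
  finally show "emeasure (euclidean_lborel n) (euclidean_unit_ball n) < \<infinity>" unfolding eq .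
qed

section \<open>Contact points in Loewner position\<close>

text \<open>By forward substitution a nonzero diagonal makes the linear part \<open>f\<close>
  invertible on the carrier; the set is the image of the ball under the inverse \<open>g\<close>,
  translated by \<open>- g b\<close>.\<close>

lemma ellipsoid_triangular_ellipsoid:
  assumes a: "\<And>i. i < n \<Longrightarrow> a i \<noteq> 0"
  shows "ellipsoid n (triangular_ellipsoid n a L h)"
proof -
  define f where "f = (\<lambda>x i. if i < n then a i * x i + (\<Sum>j<i. L i j * x j) else 0)"
  define b where "b = (\<lambda>i. if i < n then h i else 0)"
  have "linear f"
    by (rule linearI) (auto simp: f_def fun_eq_iff algebra_simps sum.distrib sum_distrib_left)
  moreover have "f ` euclidean_carrier n \<subseteq> euclidean_carrier n"
    by (auto simp: f_def euclidean_carrier_iff)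
  moreover have "inj_on f (euclidean_carrier n)"
  proof (rule inj_onI, rule ext)
    fix x y i assume xy: "x \<in> euclidean_carrier n" "y \<in> euclidean_carrier n" "f x = f y"
    show "x i = y i"
    proof (induction i rule: less_induct)
      case (less i)
      show ?case
      proof (cases "i < n")
        case True
        then have "a i * x i + (\<Sum>j<i. L i j * x j) = a i * y i + (\<Sum>j<i. L i j * y j)"
          using fun_cong[OF xy(3), of i] by (simp add: f_def)
        moreover have "(\<Sum>j<i. L i j * x j) = (\<Sum>j<i. L i j * y j)"
          using less.IH by (intro sum.cong) auto
        ultimately show ?thesis using a[OF True] by simp
      qed (use xy in \<open>simp add: euclidean_carrier_iff\<close>)
    qed
  qed
  ultimately obtain g where g: "linear g" "bij_betw g (euclidean_carrier n) (euclidean_carrier n)"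
    "\<And>x. x \<in> euclidean_carrier n \<Longrightarrow> g (f x) = x" "\<And>x. x \<in> euclidean_carrier n \<Longrightarrow> f (g x) = x"
    by (rule linear_bij_betw_carrier_inverse) blast
  have gV: "g x \<in> euclidean_carrier n" if "x \<in> euclidean_carrier n" for x
    using g(2) that by (auto simp: bij_betw_def)
  have fV: "f x \<in> euclidean_carrier n" for x by (simp add: f_def euclidean_carrier_iff)
  have bV: "b \<in> euclidean_carrier n" by (simp add: b_def euclidean_carrier_iff)
  note sub = subspace_add[OF subspace_euclidean_carrier] subspace_diff[OF subspace_euclidean_carrier]
    subspace_neg[OF subspace_euclidean_carrier]
  have mem: "x \<in> triangular_ellipsoid n a L h \<longleftrightarrow> x \<in> euclidean_carrier n \<and> f x + b \<in> euclidean_unit_ball n" for x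
  proof -
    have "ip n (triangular_map a L h x) (triangular_map a L h x) = ip n (f x + b) (f x + b)"
      by (rule ip_cong) (simp_all add: triangular_map_def f_def b_def)
    then show ?thesis using sub(1)[OF fV bV] unfolding triangular_ellipsoid_def euclidean_unit_ball_iff by simp
  qed
  have "triangular_ellipsoid n a L h = (\<lambda>x. - g b + g x) ` euclidean_unit_ball n"
  proof (intro equalityI subsetI)
    fix x assume x: "x \<in> triangular_ellipsoid n a L h"
    then have "g (f x + b) = x + g b"
      using g(3)[of x] linear_add[OF g(1), of "f x" b] unfolding mem by simp
    then have "x = - g b + g (f x + b)" by simp
    then show "x \<in> (\<lambda>x. - g b + g x) ` euclidean_unit_ball n" using x unfolding mem by blast
  next
    fix x assume "x \<in> (\<lambda>x. - g b + g x) ` euclidean_unit_ball n"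
    then obtain y where y: "y \<in> euclidean_unit_ball n" "x = - g b + g y" by blast
    then have yV: "y \<in> euclidean_carrier n" by (simp add: euclidean_unit_ball_iff)
    have x: "x = g (y - b)" using y(2) linear_diff[OF g(1), of y b] by simp
    have "f x + b = y" using g(4)[OF sub(2)[OF yV bV]] unfolding x by simp
    then show "x \<in> triangular_ellipsoid n a L h"
      using gV[OF sub(2)[OF yV bV]] y(1) unfolding mem x by simp
  qed
  moreover have "- g b \<in> euclidean_carrier n" by (intro sub(3) gV bV)
  ultimately show ?thesis using g(1,2) unfolding ellipsoid_def by blast
qed

text \<open>Folding the entries above the diagonal onto those below gives a lower triangular matrix
  with the same quadratic form and the same trace.\<close>

lemma sum_square_eq_triangular:
  fixes M :: "nat \<Rightarrow> nat \<Rightarrow> real"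
  shows "(\<Sum>i<n. \<Sum>j<n. M i j * x i * x j) =
    (\<Sum>i<n. x i * (M i i * x i + (\<Sum>j<i. (M i j + M j i) * x j)))"
proof (induction n)
  case (Suc n)
  have "(\<Sum>i<Suc n. \<Sum>j<Suc n. M i j * x i * x j) = (\<Sum>i<n. \<Sum>j<n. M i j * x i * x j)
    + (\<Sum>i<n. M i n * x i * x n) + (\<Sum>j<n. M n j * x n * x j) + M n n * x n * x n"
    by (simp add: sum.distrib)
  then show ?case unfolding Suc.IH
    by (simp add: algebra_simps sum.distrib sum_distrib_left)
qed simp

text \<open>The derivative of the determinant at the identity is the trace, so the product increases
  from its value 1 at \<open>t = 0\<close>.\<close>

lemma prod_one_plus_gt_one:
  fixes m :: "nat \<Rightarrow> real"
  assumes "0 < (\<Sum>i<n. m i)"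
  obtains d where "0 < d" "\<And>t. 0 < t \<Longrightarrow> t < d \<Longrightarrow> 1 < (\<Prod>i<n. 1 + t * m i)"
proof -
  have "((\<lambda>t. \<Prod>i<n. 1 + t * m i) has_real_derivative (\<Sum>i<n. m i)) (at 0)" for n
  proof (induction n)
    case (Suc n)
    show ?case unfolding prod.lessThan_Suc
      by (rule derivative_eq_intros Suc.IH refl | simp)+
  qed simp
  from DERIV_pos_inc_right[OF this assms] show ?thesis using that by auto
qed

text \<open>If the quadratic polynomial were negative on the contact set, flowing along its gradient
  field, made lower triangular, would push \<open>K\<close> into the open ball to first order while expanding
  volume, so that a smaller ellipsoid would contain \<open>K\<close>.\<close>

lemma loewner_position_isotropic_dual:
  assumes n: "1 \<le> n" and K: "compact K" and loewner: "loewner_position n K"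
  shows "isotropic_dual n (K \<inter> euclidean_unit_sphere n)"
  unfolding isotropic_dual_def
proof (intro conjI ballI allI impI)
  fix u assume "u \<in> K \<inter> euclidean_unit_sphere n"
  then show "ip n u u = 1" by (simp add: euclidean_unit_sphere_iff)
next
  fix M :: "nat \<Rightarrow> nat \<Rightarrow> real" and h :: "nat \<Rightarrow> real"
  assume tr: "0 < (\<Sum>i<n. M i i)"
  have KB: "K \<subseteq> euclidean_unit_ball n"
    and min: "\<And>E. ellipsoid n E \<Longrightarrow> K \<subseteq> E \<Longrightarrow>
      emeasure (euclidean_lborel n) (euclidean_unit_ball n) \<le> emeasure (euclidean_lborel n) E"
    using loewner by (auto simp: loewner_position_def minimal_volume_ellipsoid_def)
  define L where "L = (\<lambda>i j. M i j + M j i)"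
  define w where "w = triangular_map (\<lambda>i. M i i) L h"
  define q where "q = (\<lambda>x. ip n x (w x))"
  have q_eq: "(\<Sum>i<n. \<Sum>j<n. M i j * x i * x j) + ip n h x = q x" for x
    unfolding sum_square_eq_triangular
    by (simp add: q_def w_def ip_def triangular_map_def L_def algebra_simps sum.distrib)
  have cont: "continuous_on K w" "continuous_on K q" "continuous_on K (\<lambda>x. ip n x x)"
    "continuous_on K (\<lambda>x. ip n (w x) (w x))"
    unfolding q_def w_def
    by (intro continuous_on_ip continuous_on_triangular_map continuous_on_id)+
  show "\<exists>u\<in>K \<inter> euclidean_unit_sphere n. 0 \<le> (\<Sum>i<n. \<Sum>j<n. M i j * u i * u j) + ip n h u"
  proof (rule ccontr)
    assume none: "\<not> ?thesis"
    have neg: "q u < 0" if "u \<in> K" "ip n u u = 1" for u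
    proof -
      have "u \<in> K \<inter> euclidean_unit_sphere n"
        using that KB by (auto simp: euclidean_unit_sphere_iff euclidean_unit_ball_iff)
      then show ?thesis using none unfolding q_eq by (meson not_le)
    qed
    have le1: "ip n x x \<le> 1" and KV: "x \<in> euclidean_carrier n" if "x \<in> K" for x
      using KB that by (auto simp: euclidean_unit_ball_iff)
    \<comment> \<open>Compactness makes the alternative uniform: the minimum of \<open>q x\<close>
      and |x|^2 - 1 is negative on \<open>K\<close>, and its maximum over a nonempty
      \<open>K\<close> is taken as -\<gamma>.\<close>
    obtain \<gamma> where \<gamma>: "0 < \<gamma>" "\<And>x. x \<in> K \<Longrightarrow> q x \<le> - \<gamma> \<or> ip n x x \<le> 1 - \<gamma>"
    proof (cases "K = {}")
      case True
      then show ?thesis using that[of 1] by simp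
    next
      case False
      have "continuous_on K (\<lambda>x. min (q x) (ip n x x - 1))"
        by (intro continuous_intros cont)
      then obtain z where z: "z \<in> K"
        "\<And>x. x \<in> K \<Longrightarrow> min (q x) (ip n x x - 1) \<le> min (q z) (ip n z z - 1)"
        using continuous_attains_sup[OF K False] by blast
      have "min (q z) (ip n z z - 1) < 0"
        using neg[OF z(1)] le1[OF z(1)] by (auto simp: min_less_iff_disj)
      then show ?thesis using z(2)
        by (intro that[of "- min (q z) (ip n z z - 1)"]) (fastforce simp: min_le_iff_disj)+
    qed
    have bdd: "\<exists>R\<ge>0. \<forall>x\<in>K. f x \<le> R" if cf: "continuous_on K f" for f :: "(nat \<Rightarrow> real) \<Rightarrow> real"
    proof (cases "K = {}")
      case False
      then obtain z where "z \<in> K" "\<forall>x\<in>K. f x \<le> f z"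
        using continuous_attains_sup[OF K False cf] by blast
      then show ?thesis by (intro exI[of _ "\<bar>f z\<bar>"]) force
    qed auto
    obtain G where G: "0 \<le> G" "\<And>x. x \<in> K \<Longrightarrow> q x \<le> G" using bdd[OF cont(2)] by blast
    obtain R where R: "0 \<le> R" "\<And>x. x \<in> K \<Longrightarrow> ip n (w x) (w x) \<le> R" using bdd[OF cont(4)] by blast
    obtain d where d: "0 < d" "\<And>t. 0 < t \<Longrightarrow> t < d \<Longrightarrow> 1 < (\<Prod>i<n. 1 + t * M i i)"
      using prod_one_plus_gt_one[OF tr] by blast
    \<comment> \<open>\<open>t < d\<close> keeps the determinant above 1. Where |x|^2 <= 1 -
      \<gamma>, the bound t (2 G + R) <= \<gamma> absorbs the growth; where q x <= -\<gamma>, the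
      first-order decrease beats the second-order term as t R <= \<gamma>.\<close>
    define t where "t = min (d / 2) (min 1 (\<gamma> / (2 * G + R + 1)))"
    have GR: "0 < 2 * G + R + 1" using G R by simp
    have "t \<le> d / 2" unfolding t_def by (rule min.cobounded1)
    then have t: "0 < t" "t < d" "t \<le> 1" "t \<le> \<gamma> / (2 * G + R + 1)"
      using d(1) \<gamma>(1) divide_pos_pos[OF \<gamma>(1) GR] by (simp_all add: t_def)
    have t\<gamma>: "t * (2 * G) + t * R \<le> \<gamma>"
      using t(1,4) GR by (simp add: pos_le_divide_eq algebra_simps)
    define a where "a = (\<lambda>i. 1 + t * M i i)"
    define E where "E = triangular_ellipsoid n a (\<lambda>i j. t * L i j) (\<lambda>i. t * h i)"
    have gt: "1 < (\<Prod>i<n. a i)" unfolding a_def using d(2) t by blast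
    have a0: "a i \<noteq> 0" if "i < n" for i
    proof
      assume "a i = 0"
      then have "(\<Prod>i<n. a i) = 0" using that by (intro prod_zero) auto
      then show False using gt by linarith
    qed
    have "K \<subseteq> E"
    proof
      fix x assume x: "x \<in> K"
      have "triangular_map a (\<lambda>i j. t * L i j) (\<lambda>i. t * h i) x = x + t *\<^sub>R w x"
        by (simp add: fun_eq_iff triangular_map_def a_def w_def algebra_simps sum_distrib_left)
      then have "ip n (triangular_map a (\<lambda>i j. t * L i j) (\<lambda>i. t * h i) x)
          (triangular_map a (\<lambda>i j. t * L i j) (\<lambda>i. t * h i) x) = ip n (x + t *\<^sub>R w x) (x + t *\<^sub>R w x)"
        by (simp only:)
      also have "\<dots> = ip n x x + 2 * (t * q x) + t * (t * ip n (w x) (w x))"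
        using ip_commute[of n "w x" x] by (simp add: q_def algebra_simps)
      also have "\<dots> \<le> 1"
      proof -
        have tR: "t * (t * ip n (w x) (w x)) \<le> t * (t * R)"
          using R(2)[OF x] t(1) by (intro mult_left_mono) simp_all
        have tR': "t * (t * R) \<le> t * R"
          using mult_right_mono[OF t(3) R(1)] t(1) by (intro mult_left_mono) simp_all
        show ?thesis
          using \<gamma>(2)[OF x]
        proof
          assume "q x \<le> - \<gamma>"
          then have "t * q x \<le> t * - \<gamma>" using t(1) by (intro mult_left_mono) simp_all
          moreover have "t * (t * R) \<le> t * \<gamma>"
            using t\<gamma> t(1) G(1) mult_nonneg_nonneg[of t G] by (intro mult_left_mono) linarith+
          moreover have "0 \<le> t * \<gamma>" using t \<gamma> by simp
          ultimately show ?thesis using tR le1[OF x] by linarith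
        next
          assume "ip n x x \<le> 1 - \<gamma>"
          moreover have "t * q x \<le> t * G" using G(2)[OF x] t(1) by (intro mult_left_mono) simp_all
          ultimately show ?thesis using tR tR' t\<gamma> by linarith
        qed
      qed
      finally show "x \<in> E" using KV[OF x] by (simp add: E_def triangular_ellipsoid_def)
    qed
    then have le: "emeasure (euclidean_lborel n) (euclidean_unit_ball n) \<le> emeasure (euclidean_lborel n) E"
      unfolding E_def by (intro min ellipsoid_triangular_ellipsoid a0)
    define v e \<kappa> where "v = emeasure (euclidean_lborel n) (euclidean_unit_ball n)"
      and "e = emeasure (euclidean_lborel n) E" and "\<kappa> = \<bar>\<Prod>i<n. a i\<bar>"
    have v: "v = ennreal \<kappa> * e"
      using emeasure_unit_ball_eq[OF a0, where L = "\<lambda>i j. t * L i j" and h = "\<lambda>i. t * h i"]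
      unfolding v_def e_def E_def \<kappa>_def by (simp add: prod_ennreal abs_prod)
    have \<kappa>: "1 < \<kappa>" using gt unfolding \<kappa>_def by linarith
    have pos: "0 < v" and fin: "v < \<infinity>" using emeasure_unit_ball_pos_finite[OF n] by (simp_all add: v_def)
    have ve: "v \<le> e" using le by (simp add: v_def e_def)
    \<comment> \<open>\<open>v = ennreal \<kappa> * e\<close> with \<open>\<kappa> > 1\<close>
      contradicts \<open>v \<le> e\<close>: for finite \<open>e\<close> by positivity of
      \<open>v\<close>, for infinite \<open>e\<close> by finiteness of \<open>v\<close>.\<close>
    show False
    proof (cases e rule: ennreal_cases)
      case (real r)
      have "0 < ennreal r" using pos ve real(2) by (metis less_le_trans)
      then have "0 < r" by simp
      have "ennreal (\<kappa> * r) \<le> ennreal r"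
        using v ve real \<kappa> by (simp add: ennreal_mult)
      then have "\<kappa> * r \<le> 1 * r" using real by simp
      then show False using \<kappa> \<open>0 < r\<close> by (simp add: mult_le_cancel_right)
    next
      case top
      then show False using v fin \<kappa> by (simp add: ennreal_mult_top)
    qed
  qed
qed

section \<open>Choice of the parameter and the dilated hull\<close>

theorem proposition1p6:
  shows "\<exists>\<alpha> C :: real. \<alpha> > 0 \<and> C > 0 \<and>
    (\<forall>(\<delta>::real) (n::nat) (K :: (nat \<Rightarrow> real) set).
       1 \<le> \<delta> \<and> \<delta> \<le> 2 \<and> n \<ge> 1 \<and> convex_body n K \<and> loewner_position n K \<longrightarrow>
       (\<exists>X. X \<subseteq> K \<inter> euclidean_unit_sphere n \<and>
            finite X \<and> real (card X) \<le> \<alpha> * real n powr \<delta> \<and>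
            K \<subseteq> euclidean_unit_ball n \<and>
            euclidean_unit_ball n \<subseteq>
              (\<lambda>x. (C * real n powr (2 - \<delta> / 2)) *\<^sub>R x) ` (convex hull X)))"
proof (rule exI[of _ 43], rule exI[of _ 2500], intro conjI allI impI)
  fix \<delta> :: real and n :: nat and K :: "(nat \<Rightarrow> real) set"
  assume "1 \<le> \<delta> \<and> \<delta> \<le> 2 \<and> n \<ge> 1 \<and> convex_body n K \<and> loewner_position n K"
  then have \<delta>: "1 \<le> \<delta>" "\<delta> \<le> 2" and n: "1 \<le> n" and body: "convex_body n K" and loewner: "loewner_position n K"
    by auto
  have KB: "K \<subseteq> euclidean_unit_ball n"
    using loewner by (simp add: loewner_position_def minimal_volume_ellipsoid_def)
  have "compactin (powertop_real UNIV) K"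
    using body by (simp add: convex_body_def Euclidean_space_def compactin_subtopology)
  then have "compact K" by (simp add: euclidean_product_topology)
  let ?S = "K \<inter> euclidean_unit_sphere n"
  have S: "isotropic_dual n ?S" by (rule loewner_position_isotropic_dual[OF n \<open>compact K\<close> loewner])
  have SV: "?S \<subseteq> euclidean_carrier n" by (auto simp: euclidean_unit_sphere_iff)
  have n0: "1 \<le> real n" using n by simp
  \<comment> \<open>This \<open>k\<close> takes the place of \<open>K\<close> in the selection: n k
    = n^\<delta> for the cardinality and sqrt k / n^(3/2) = n^(\<delta>/2 - 2) for the radius, while
    the range of \<open>\<delta>\<close> gives 1 <= k <= n.\<close>
  define k where "k = real n powr (\<delta> - 1)"
  have k: "1 \<le> k" "k \<le> real n"
    unfolding k_def using \<delta> n0 ge_one_powr_ge_zero[of "real n" "\<delta> - 1"] powr_mono[of "\<delta> - 1" 1 "real n"]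
    by simp_all
  obtain X where X: "finite X" "X \<subseteq> ?S" "real (card X) \<le> 43 * real n * k"
    "\<And>p. p \<in> euclidean_carrier n \<Longrightarrow> ip n p p \<le> (sqrt k / (2500 * real n * sqrt (real n)))\<^sup>2
      \<Longrightarrow> p \<in> convex hull X"
    using isotropic_dual_few_points[OF S n SV k] by blast
  have nk: "real n * k = real n powr \<delta>"
    using n0 by (simp add: k_def powr_mult_base)
  define c where "c = 2500 * real n powr (2 - \<delta> / 2)"
  have c0: "0 < c" using n0 by (simp add: c_def)
  have c: "sqrt k / (2500 * real n * sqrt (real n)) = 1 / c"
  proof -
    have "sqrt k = real n powr ((\<delta> - 1) / 2)" using n0 by (simp add: k_def powr_half_sqrt[symmetric] powr_powr)
    moreover have "real n * sqrt (real n) = real n powr (3 / 2)"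
      using n0 powr_add[of "real n" 1 "1 / 2"] by (simp add: powr_half_sqrt)
    moreover have "real n powr ((\<delta> - 1) / 2) * real n powr (2 - \<delta> / 2) = real n powr (3 / 2)"
      by (simp add: field_simps flip: powr_add)
    ultimately show ?thesis using n0 by (simp add: c_def field_simps)
  qed
  have "euclidean_unit_ball n \<subseteq> (\<lambda>x. c *\<^sub>R x) ` (convex hull X)"
  proof
    fix p assume p: "p \<in> euclidean_unit_ball n"
    have "(1 / c) *\<^sub>R p \<in> convex hull X"
    proof (rule X(4))
      show "(1 / c) *\<^sub>R p \<in> euclidean_carrier n"
        using p by (auto intro: subspace_scale[OF subspace_euclidean_carrier] simp: euclidean_unit_ball_iff)
      have "ip n ((1 / c) *\<^sub>R p) ((1 / c) *\<^sub>R p) = (1 / c)\<^sup>2 * ip n p p" by (simp add: power2_eq_square)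
      also have "\<dots> \<le> (1 / c)\<^sup>2 * 1"
        using p by (intro mult_left_mono) (simp_all add: euclidean_unit_ball_iff)
      finally show "ip n ((1 / c) *\<^sub>R p) ((1 / c) *\<^sub>R p) \<le> (sqrt k / (2500 * real n * sqrt (real n)))\<^sup>2"
        unfolding c by simp
    qed
    moreover have "p = c *\<^sub>R ((1 / c) *\<^sub>R p)" using c0 by simp
    ultimately show "p \<in> (\<lambda>x. c *\<^sub>R x) ` (convex hull X)" by blast
  qed
  then show "\<exists>X. X \<subseteq> ?S \<and> finite X \<and> real (card X) \<le> 43 * real n powr \<delta> \<and>
      K \<subseteq> euclidean_unit_ball n \<and>
      euclidean_unit_ball n \<subseteq> (\<lambda>x. (2500 * real n powr (2 - \<delta> / 2)) *\<^sub>R x) ` (convex hull X)"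
    using X(1-3) KB nk by (intro exI[of _ X]) (simp add: c_def mult.assoc)
qed simp_all

end
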